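(* Let $A\in\mathbb{R}^{n\times n}$ be nonsingular, $B\in\mathbb{R}^{n\times \ell}$ and $C\in\mathbb{R}^{s\times n}$ of full rank, with $\ell,s\ll n$, and let $T_f>0$. Let $m\ge 1$ and suppose that $m$ steps of the extended block Arnoldi process have been run without breakdown on the pair $(A^T,C^T)$, producing $\mathcal V_m=[V_1,\dots,V_m]\in\mathbb{R}^{n\times 2ms}$, $V_{m+1}\in\mathbb{R}^{n\times 2s}$, $\mathcal T_m=\mathcal V_m^TA^T\mathcal V_m$ and $T_{m+1,m}=V_{m+1}^TA^TV_m\in\mathbb{R}^{2s\times 2s}$. Let $B_m=\mathcal V_m^TB$ and $C_m=C\mathcal V_m$. Let $Y_m:[0,T_f]\to\mathbb{R}^{2ms\times 2ms}$ be a differentiable function with symmetric values solving the low-dimensional differential Riccati equation $$\dot Y_m-\mathcal T_mY_m-Y_m\mathcal T_m^T+Y_mB_mB_m^TY_m-C_m^TC_m=0,$$ and let $X_m=\mathcal V_mY_m\mathcal V_m^T$ be the corresponding approximate solution. Then, at every time in $[0,T_f]$, the residual $$R_m=\dot X_m-A^TX_m-X_mA+X_mBB^TX_m-C^TC$$ satisfies $$\|R_m\|=\|T_{m+1,m}\hat Y_m\|,$$ where $\hat Y_m$ is the $2s\times 2ms$ matrix consisting of the last $2s$ rows of $Y_m$.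
   Context: $\|\cdot\|$ denotes the matrix 2-norm (spectral norm). Extended block Arnoldi process applied to $(A^T,C^T)$. Compute the QR decomposition $[C^T,A^{-T}C^T]=V_1\Lambda$ with $V_1\in\mathbb{R}^{n\times 2s}$ having orthonormal columns. For $j=1,\dots,m$: let $V_j^{(1)}$ and $V_j^{(2)}$ be the first $s$ and the last $s$ columns of $V_j$; set $\hat V_{j+1}=[A^TV_j^{(1)},A^{-T}V_j^{(2)}]$; for $i=1,\dots,j$ set $H_{i,j}=V_i^T\hat V_{j+1}$ and replace $\hat V_{j+1}$ by $\hat V_{j+1}-V_iH_{i,j}$; then compute the QR decomposition $\hat V_{j+1}=V_{j+1}H_{j+1,j}$ with $V_{j+1}\in\mathbb{R}^{n\times 2s}$. "Without breakdown" means that $[C^T,A^{-T}C^T]$ has full column rank and no upper triangular matrix $H_{j+1,j}$, $1\le j\le m$, is rank deficient. Under this assumption the following standard facts hold: $\mathcal V_{m+1}=[\mathcal V_m,V_{m+1}]$ has orthonormal columns; the range of $\mathcal V_m$ is the extended block Krylov subspace spanned by the columns of $C^T,A^TC^T,\dots,(A^T)^{m-1}C^T,A^{-T}C^T,\dots,(A^{-T})^mC^T$, so that $C^T=\mathcal V_mC_m^T$; and $$A^T\mathcal V_m=\mathcal V_m\mathcal T_m+V_{m+1}T_{m+1,m}E_m^T,$$ where $E_m=[O_{2s\times 2(m-1)s},I_{2s}]^T$ is the matrix of the last $2s$ columns of the identity matrix $I_{2ms}$. The original problem being approximated is the differential Riccati equation $\dot X=A^TX+XA-XBB^TX+C^TC$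 on $[0,T_f]$, $X(0)=X_0$. *)

theory Defs
  imports
    "HOL-Analysis.Derivative"
    "Jordan_Normal_Form.Gauss_Jordan_Elimination"
    "Jordan_Normal_Form.DL_Rank"
begin

definition vnorm2 :: "real vec \<Rightarrow> real" where
  "vnorm2 v = sqrt (v \<bullet> v)"

text \<open>The spectral norm, as the operator norm induced by the Euclidean vector norm.\<close>

definition mnorm2 :: "real mat \<Rightarrow> real" where
  "mnorm2 M = (SUP v \<in> {v \<in> carrier_vec (dim_col M). vnorm2 v \<le> 1}. vnorm2 (M *\<^sub>v v))"

definition mrank :: "real mat \<Rightarrow> nat" where
  "mrank M = vec_space.rank (dim_row M) M"

definition full_rank :: "real mat \<Rightarrow> bool" where
  "full_rank M \<longleftrightarrow> mrank M = min (dim_row M) (dim_col M)"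

text \<open>Only meaningful for invertible matrices.\<close>

definition inv_mat :: "real mat \<Rightarrow> real mat" where
  "inv_mat M = the (mat_inverse M)"

definition append_cols :: "real mat \<Rightarrow> real mat \<Rightarrow> real mat" where
  "append_cols M N = (M\<^sup>T @\<^sub>r N\<^sup>T)\<^sup>T"

definition first_cols :: "nat \<Rightarrow> real mat \<Rightarrow> real mat" where
  "first_cols k M = mat (dim_row M) k (\<lambda>(i, j). M $$ (i, j))"

definition last_cols :: "nat \<Rightarrow> real mat \<Rightarrow> real mat" where
  "last_cols k M = mat (dim_row M) k (\<lambda>(i, j). M $$ (i, dim_col M - k + j))"

definition last_rows :: "nat \<Rightarrow> real mat \<Rightarrow> real mat" where
  "last_rows k M = mat k (dim_col M) (\<lambda>(i, j). M $$ (dim_row M - k + i, j))"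

text \<open>The matrix \<open>[V 1, \<dots>, V m]\<close>, whose blocks are \<open>n \<times> k\<close>.\<close>

definition concat_blocks :: "nat \<Rightarrow> nat \<Rightarrow> nat \<Rightarrow> (nat \<Rightarrow> real mat) \<Rightarrow> real mat" where
  "concat_blocks n k m V = mat n (m * k) (\<lambda>(i, j). V (j div k + 1) $$ (i, j mod k))"

text \<open>Derivatives of matrix-valued functions are taken entrywise, relative to a set \<open>S\<close> of
  times: at an endpoint of an interval \<open>S\<close> they are one-sided.\<close>

definition mat_differentiable_on :: "(real \<Rightarrow> real mat) \<Rightarrow> nat \<Rightarrow> nat \<Rightarrow> real set \<Rightarrow> bool" where
  "mat_differentiable_on F nr nc S \<longleftrightarrow>
     (\<forall>t\<in>S. F t \<in> carrier_mat nr nc) \<and>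
     (\<forall>i<nr. \<forall>j<nc. (\<lambda>t. F t $$ (i, j)) differentiable_on S)"

definition mat_deriv :: "real set \<Rightarrow> (real \<Rightarrow> real mat) \<Rightarrow> real \<Rightarrow> real mat" where
  "mat_deriv S F t = mat (dim_row (F t)) (dim_col (F t))
     (\<lambda>(i, j). vector_derivative (\<lambda>u. F u $$ (i, j)) (at t within S))"

text \<open>Thin QR decomposition \<open>M = Q R\<close>; no sign convention is imposed on the diagonal of \<open>R\<close>.\<close>

definition qr_decomp :: "real mat \<Rightarrow> real mat \<Rightarrow> real mat \<Rightarrow> bool" where
  "qr_decomp M Q R \<longleftrightarrow>
     Q \<in> carrier_mat (dim_row M) (dim_col M) \<and>
     R \<in> carrier_mat (dim_col M) (dim_col M) \<and>
     Q\<^sup>T * Q = 1\<^sub>m (dim_col M) \<and> upper_triangular R \<and> M = Q * R"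

definition eba_start :: "real mat \<Rightarrow> real mat \<Rightarrow> real mat" where
  "eba_start F G = append_cols G (inv_mat F * G)"

definition eba_expand :: "real mat \<Rightarrow> nat \<Rightarrow> real mat \<Rightarrow> real mat" where
  "eba_expand F s U = append_cols (F * first_cols s U) (inv_mat F * last_cols s U)"

text \<open>\<open>m\<close> steps of the extended block Arnoldi process on the pair \<open>(F, G)\<close>, where \<open>G\<close> has \<open>s\<close>
  columns.  In step \<open>j\<close>, \<open>W i\<close> is the content of the working block
  after it has been orthogonalised against \<open>V 1, \<dots>, V i\<close>.\<close>

definition eba_process ::
  "real mat \<Rightarrow> real mat \<Rightarrow> nat \<Rightarrow> nat \<Rightarrow> (nat \<Rightarrow> real mat) \<Rightarrow> real mat \<Rightarrow> (nat \<Rightarrow> nat \<Rightarrow> real mat) \<Rightarrow> bool"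
where
  "eba_process F G s m V \<Lambda> H \<longleftrightarrow>
     qr_decomp (eba_start F G) (V 1) \<Lambda> \<and>
     (\<forall>j\<in>{1..m}. \<exists>W :: nat \<Rightarrow> real mat.
        W 0 = eba_expand F s (V j) \<and>
        (\<forall>i\<in>{1..j}. H i j = (V i)\<^sup>T * W (i - 1) \<and> W i = W (i - 1) - V i * H i j) \<and>
        qr_decomp (W j) (V (j + 1)) (H (j + 1) j))"

definition eba_no_breakdown ::
  "real mat \<Rightarrow> real mat \<Rightarrow> nat \<Rightarrow> (nat \<Rightarrow> nat \<Rightarrow> real mat) \<Rightarrow> bool"
where
  "eba_no_breakdown F G m H \<longleftrightarrow>
     mrank (eba_start F G) = dim_col (eba_start F G) \<and>
     (\<forall>j\<in>{1..m}. full_rank (H (j + 1) j))"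

end

theory Submission
  imports Defs
begin

text \<open>
  Write \<open>F = A\<^sup>T\<close> and \<open>G = C\<^sup>T\<close>, and let \<open>P j\<close> be the orthogonal projection onto the span of
  \<open>V 1, \<dots>, V j\<close>. Modified Gram-Schmidt makes the blocks mutually orthogonal, because the triangular
  factors are invertible. The key point is that \<open>F (V j)\<close> lies in the range of \<open>P (j + 1)\<close>, which
  gives the Arnoldi relation \<open>F Vm = Vm Tm + W K\<close> with \<open>W = V (m + 1)\<close> and
  \<open>K Y = Tsub (last_rows Y)\<close>. Substituting this, the reduced Riccati equation and \<open>G = Vm Cm\<^sup>T\<close> into
  the residual leaves \<open>- (W M Vm\<^sup>T + Vm M\<^sup>T W\<^sup>T)\<close> with \<open>M = Tsub (last_rows Y)\<close>. As \<open>W\<close> and \<open>Vm\<close> have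
  orthonormal columns and orthogonal ranges, this matrix acts as \<open>M\<close> from the range of \<open>Vm\<close> to that
  of \<open>W\<close> and as \<open>M\<^sup>T\<close> in the opposite direction, so Pythagoras' theorem shows that its norm
  is that of \<open>M\<close>.
\<close>

section \<open>Matrix algebra with explicit dimensions\<close>

lemma mult_assoc_dim:
  fixes A B C :: "real mat"
  shows "dim_col A = dim_row B \<Longrightarrow> dim_col B = dim_row C \<Longrightarrow> A * B * C = A * (B * C)"
  by (rule assoc_mult_mat) auto

lemma mult_add_dim:
  fixes A B C :: "real mat"
  shows "dim_col A = dim_row B \<Longrightarrow> dim_row B = dim_row C \<Longrightarrow> dim_col B = dim_col C \<Longrightarrow>
    A * (B + C) = A * B + A * C"
  by (rule mult_add_distrib_mat) auto

lemma add_mult_dim: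
  fixes A B C :: "real mat"
  shows "dim_row A = dim_row B \<Longrightarrow> dim_col A = dim_col B \<Longrightarrow> dim_col B = dim_row C \<Longrightarrow>
    (A + B) * C = A * C + B * C"
  by (rule add_mult_distrib_mat) auto

lemma mult_diff_dim:
  fixes A B C :: "real mat"
  shows "dim_col A = dim_row B \<Longrightarrow> dim_row B = dim_row C \<Longrightarrow> dim_col B = dim_col C \<Longrightarrow>
    A * (B - C) = A * B - A * C"
  by (rule mult_minus_distrib_mat) auto

lemma diff_mult_dim:
  fixes A B C :: "real mat"
  shows "dim_row A = dim_row B \<Longrightarrow> dim_col A = dim_col B \<Longrightarrow> dim_col B = dim_row C \<Longrightarrow>
    (A - B) * C = A * C - B * C"
  by (rule minus_mult_distrib_mat) auto

lemma transpose_mult_dim: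
  fixes A B :: "real mat"
  shows "dim_col A = dim_row B \<Longrightarrow> (A * B)\<^sup>T = B\<^sup>T * A\<^sup>T"
  by (rule transpose_mult[of _ "dim_row A" "dim_col A"]) auto

lemma mult_zero_dim:
  fixes A :: "real mat"
  shows "dim_col A = k \<Longrightarrow> A * 0\<^sub>m k c = 0\<^sub>m (dim_row A) c"
    and "dim_row A = k \<Longrightarrow> 0\<^sub>m r k * A = 0\<^sub>m r (dim_col A)"
  by auto

lemma mult_one_dim:
  fixes A :: "real mat"
  shows "dim_col A = k \<Longrightarrow> A * 1\<^sub>m k = A"
    and "dim_row A = k \<Longrightarrow> 1\<^sub>m k * A = A"
  by auto

lemma transpose_add_dim:
  fixes A B :: "real mat"
  shows "dim_row A = dim_row B \<Longrightarrow> dim_col A = dim_col B \<Longrightarrow> (A + B)\<^sup>T = A\<^sup>T + B\<^sup>T"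
  by auto

text \<open>Matrices of all sizes share one type, which is not an additive group, so cancellation is
  argued entrywise under explicit sizes.\<close>

lemma diff_right_cancel_mat:
  fixes A B C :: "real mat"
  assumes eq: "A - C = B - C"
    and dims: "dim_row A = dim_row C" "dim_col A = dim_col C" "dim_row B = dim_row C" "dim_col B = dim_col C"
  shows "A = B"
proof (rule eq_matI)
  fix i j assume "i < dim_row B" "j < dim_col B"
  then show "A $$ (i, j) = B $$ (i, j)"
    using arg_cong[OF eq, of "\<lambda>M. M $$ (i, j)"] dims by simp
qed (use dims in simp_all)

text \<open>Normalises to sums of right-nested products. The premises speak only of
  \<open>dim_row\<close> and \<open>dim_col\<close> of matrices in the equation, so the simplifier
  can discharge them; carrier premises would bring in dimensions that the equation does not
  determine.\<close>

lemmas mat_dim_simps = mult_assoc_dim mult_add_dim add_mult_dim mult_diff_dim diff_mult_dim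
  transpose_mult_dim mult_zero_dim mult_one_dim

subsection \<open>The spectral norm\<close>

lemma vnorm2_nonneg [simp]: "0 \<le> vnorm2 v"
  by (auto simp: vnorm2_def scalar_prod_def intro: sum_nonneg)

lemma vnorm2_power2: "(vnorm2 v)\<^sup>2 = v \<bullet> v"
  by (auto simp: vnorm2_def scalar_prod_def intro: sum_nonneg)

lemma vnorm2_zero [simp]: "vnorm2 (0\<^sub>v n) = 0"
  by (simp add: vnorm2_def)

lemma vnorm2_smult: "vnorm2 (c \<cdot>\<^sub>v v) = \<bar>c\<bar> * vnorm2 v"
proof -
  have "(vnorm2 (c \<cdot>\<^sub>v v))\<^sup>2 = (\<bar>c\<bar> * vnorm2 v)\<^sup>2"
    by (simp add: vnorm2_power2 power_mult_distrib) (simp add: power2_eq_square)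
  then show ?thesis
    by (simp add: power2_eq_iff_nonneg)
qed

lemma vnorm2_uminus [simp]: "vnorm2 (- v) = vnorm2 v"
  by (simp add: vnorm2_def)

lemma vnorm2_eq_0_iff: "vnorm2 v = 0 \<longleftrightarrow> v = 0\<^sub>v (dim_vec v)"
proof -
  have "vnorm2 v = 0 \<longleftrightarrow> (\<forall>i<dim_vec v. v $ i = 0)"
    by (auto simp: vnorm2_def scalar_prod_def sum_nonneg_eq_0_iff)
  then show ?thesis by (auto simp: vec_eq_iff)
qed

text \<open>With \<open>vnorm2\<close> read as \<open>L2_set\<close> over the index range, this is
  the Cauchy-Schwarz inequality for finite sums.\<close>

lemma vec_Cauchy_Schwarz:
  assumes "dim_vec u = dim_vec v"
  shows "\<bar>u \<bullet> v\<bar> \<le> vnorm2 u * vnorm2 v"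
proof -
  have L2: "vnorm2 w = L2_set (($) w) {0..<dim_vec w}" for w
    by (simp add: vnorm2_def scalar_prod_def L2_set_def power2_eq_square)
  have "\<bar>u \<bullet> v\<bar> \<le> (\<Sum>i\<in>{0..<dim_vec v}. \<bar>u $ i\<bar> * \<bar>v $ i\<bar>)"
    by (simp add: scalar_prod_def abs_mult[symmetric])
  also have "\<dots> \<le> vnorm2 u * vnorm2 v"
    unfolding L2 assms by (rule L2_set_mult_ineq)
  finally show ?thesis .
qed

text \<open>The supremum in \<open>mnorm2\<close> is an upper bound only once its set is known to be
  bounded above. Any finite constant serves.\<close>

lemma vnorm2_mult_mat_vec_bounded:
  "\<exists>c\<ge>0. \<forall>v\<in>carrier_vec (dim_col M). vnorm2 (M *\<^sub>v v) \<le> c * vnorm2 v"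
proof (intro exI conjI ballI)
  \<comment> \<open>The Frobenius norm, as the Euclidean norm of the vector of row norms;
    Cauchy-Schwarz is applied row by row.\<close>
  let ?c = "L2_set (\<lambda>i. vnorm2 (row M i)) {0..<dim_row M}"
  show "0 \<le> ?c" by simp
  fix v :: "real vec" assume v: "v \<in> carrier_vec (dim_col M)"
  have "(vnorm2 (M *\<^sub>v v))\<^sup>2 = (\<Sum>i\<in>{0..<dim_row M}. (row M i \<bullet> v)\<^sup>2)"
    unfolding vnorm2_power2 by (simp add: scalar_prod_def[of "M *\<^sub>v v"] power2_eq_square)
  also have "\<dots> \<le> (\<Sum>i\<in>{0..<dim_row M}. (vnorm2 (row M i))\<^sup>2 * (vnorm2 v)\<^sup>2)"
  proof (rule sum_mono)
    fix i
    have "\<bar>row M i \<bullet> v\<bar>\<^sup>2 \<le> (vnorm2 (row M i) * vnorm2 v)\<^sup>2"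
      using v by (intro power_mono vec_Cauchy_Schwarz) auto
    then show "(row M i \<bullet> v)\<^sup>2 \<le> (vnorm2 (row M i))\<^sup>2 * (vnorm2 v)\<^sup>2"
      by (simp add: power_mult_distrib)
  qed
  also have "\<dots> = (?c * vnorm2 v)\<^sup>2"
    by (simp add: sum_distrib_right L2_set_def power_mult_distrib sum_nonneg)
  finally show "vnorm2 (M *\<^sub>v v) \<le> ?c * vnorm2 v"
    by (rule power2_le_imp_le) simp
qed

lemma vnorm2_le_mnorm2:
  assumes v: "v \<in> carrier_vec (dim_col M)" "vnorm2 v \<le> 1"
  shows "vnorm2 (M *\<^sub>v v) \<le> mnorm2 M"
proof -
  obtain c where c: "c \<ge> 0" "\<And>v. v \<in> carrier_vec (dim_col M) \<Longrightarrow> vnorm2 (M *\<^sub>v v) \<le> c * vnorm2 v"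
    using vnorm2_mult_mat_vec_bounded[of M] by auto
  have "vnorm2 (M *\<^sub>v v) \<le> c" if "v \<in> carrier_vec (dim_col M)" "vnorm2 v \<le> 1" for v
    using c(2)[OF that(1)] mult_left_mono[OF that(2) c(1)] by simp
  then show ?thesis
    unfolding mnorm2_def using v by (intro cSUP_upper) (auto intro!: bdd_aboveI2)
qed

lemma mnorm2_le:
  assumes "\<And>v. v \<in> carrier_vec (dim_col M) \<Longrightarrow> vnorm2 v \<le> 1 \<Longrightarrow> vnorm2 (M *\<^sub>v v) \<le> c"
  shows "mnorm2 M \<le> c"
  unfolding mnorm2_def using assms by (intro cSUP_least) (auto intro: exI[of _ "0\<^sub>v (dim_col M)"])

lemma mnorm2_nonneg: "0 \<le> mnorm2 M"
  using vnorm2_le_mnorm2[of "0\<^sub>v (dim_col M)" M] order_trans[OF vnorm2_nonneg] by simp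

lemma vnorm2_mult_mat_vec_le:
  assumes v: "v \<in> carrier_vec (dim_col M)"
  shows "vnorm2 (M *\<^sub>v v) \<le> mnorm2 M * vnorm2 v"
proof (cases "vnorm2 v = 0")
  case True
  then have v0: "v = 0\<^sub>v (dim_col M)" using v by (simp add: vnorm2_eq_0_iff)
  have "M *\<^sub>v v = 0\<^sub>v (dim_row M)" unfolding v0 by auto
  then show ?thesis using True by simp
next
  case False
  let ?u = "(1 / vnorm2 v) \<cdot>\<^sub>v v"
  have "vnorm2 ?u \<le> 1" using False by (simp add: vnorm2_smult)
  then have "vnorm2 (M *\<^sub>v ?u) \<le> mnorm2 M" using v by (intro vnorm2_le_mnorm2) auto
  moreover have "M *\<^sub>v ?u = (1 / vnorm2 v) \<cdot>\<^sub>v (M *\<^sub>v v)"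
    using v by (intro mult_mat_vec) auto
  moreover have "vnorm2 v > 0" using False vnorm2_nonneg[of v] by linarith
  ultimately show ?thesis
    by (simp add: vnorm2_smult field_simps)
qed

text \<open>Transposition does not increase the norm: for \<open>x = M\<^sup>T b\<close>, the square
  of the norm of \<open>x\<close> is \<open>b \<bullet> M x\<close>, at most the norm of
  \<open>b\<close> times \<open>mnorm2 M\<close> times the norm of \<open>x\<close>; one factor
  cancels unless it is zero.\<close>

lemma vnorm2_mult_transpose_le:
  assumes b: "b \<in> carrier_vec (dim_row M)"
  shows "vnorm2 (M\<^sup>T *\<^sub>v b) \<le> mnorm2 M * vnorm2 b"
proof -
  let ?x = "M\<^sup>T *\<^sub>v b"
  have x: "?x \<in> carrier_vec (dim_col M)" by (intro carrier_vecI) simp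
  have "(vnorm2 ?x)\<^sup>2 = b \<bullet> (M *\<^sub>v ?x)"
    using transpose_vec_mult_scalar[OF carrier_mat_triv x b] by (simp add: vnorm2_power2)
  also have "\<dots> \<le> vnorm2 b * vnorm2 (M *\<^sub>v ?x)"
    using vec_Cauchy_Schwarz[of b "M *\<^sub>v ?x"] b by auto
  also have "\<dots> \<le> vnorm2 b * (mnorm2 M * vnorm2 ?x)"
    using x by (intro mult_left_mono vnorm2_mult_mat_vec_le) auto
  finally have *: "vnorm2 ?x * vnorm2 ?x \<le> (mnorm2 M * vnorm2 b) * vnorm2 ?x"
    by (simp add: power2_eq_square mult_ac)
  show ?thesis
  proof (cases "vnorm2 ?x = 0")
    case True
    then show ?thesis using mnorm2_nonneg[of M] by simp
  next
    case False
    then have "vnorm2 ?x > 0" using vnorm2_nonneg[of ?x] by linarith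
    then show ?thesis using * by (simp add: mult_le_cancel_right)
  qed
qed

lemma mnorm2_uminus: "mnorm2 (- M) = mnorm2 M"
proof -
  have "vnorm2 (- M *\<^sub>v v) = vnorm2 (M *\<^sub>v v)" if "v \<in> carrier_vec (dim_col M)" for v
    using that by simp
  then show ?thesis by (simp add: mnorm2_def)
qed

text \<open>Pythagoras: moving a factor across the scalar product turns the cross terms into
  products with \<open>W\<^sup>T * V\<close> or its transpose, and the square terms into products
  with the identity.\<close>

lemma scalar_prod_orthonormal:
  assumes V: "V \<in> carrier_mat n p" "V\<^sup>T * V = 1\<^sub>m p" and W: "W \<in> carrier_mat n k" "W\<^sup>T * W = 1\<^sub>m k"
    and VW: "W\<^sup>T * V = 0\<^sub>m k p" and a: "a \<in> carrier_vec p" and b: "b \<in> carrier_vec k"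
  shows "(V *\<^sub>v a + W *\<^sub>v b) \<bullet> (V *\<^sub>v a + W *\<^sub>v b) = a \<bullet> a + b \<bullet> (b :: real vec)"
proof -
  have 1: "(M *\<^sub>v x) \<bullet> (N *\<^sub>v y) = x \<bullet> (M\<^sup>T * N *\<^sub>v y)"
    if "M \<in> carrier_mat n q" "N \<in> carrier_mat n r" "x \<in> carrier_vec q" "y \<in> carrier_vec r"
    for M N :: "real mat" and x y q r
    using that transpose_vec_mult_scalar[of "M\<^sup>T" q n "N *\<^sub>v y" x]
    by (simp add: assoc_mult_mat_vec[of _ q n _ r] comm_scalar_prod[of _ q])
  have [simp]: "0\<^sub>m k p *\<^sub>v a = 0\<^sub>v k" using a by auto
  have Wb_Va: "(W *\<^sub>v b) \<bullet> (V *\<^sub>v a) = 0"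
    using 1[OF W(1) V(1) b a] b VW by simp
  have "(V *\<^sub>v a) \<bullet> (W *\<^sub>v b) = 0"
    using Wb_Va comm_scalar_prod[of "V *\<^sub>v a" n "W *\<^sub>v b"] V W a b by simp
  then show ?thesis
    using 1[OF V(1) V(1) a a] 1[OF W(1) W(1) b b] V W a b Wb_Va
    by (simp add: add_scalar_prod_distrib[of _ n] scalar_prod_add_distrib[of _ n])
qed

text \<open>For the upper bound, Pythagoras for the image is combined with Bessel's inequality for
  the coefficients \<open>V\<^sup>T v\<close> and \<open>W\<^sup>T v\<close>. For the lower bound,
  the matrix is tested on \<open>V a\<close>, where one of the two summands is already the squared
  norm of \<open>M a\<close>.\<close>

lemma mnorm2_off_diagonal:
  assumes V: "V \<in> carrier_mat n p" "V\<^sup>T * V = 1\<^sub>m p" and W: "W \<in> carrier_mat n k" "W\<^sup>T * W = 1\<^sub>m k"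
    and WV: "W\<^sup>T * V = 0\<^sub>m k p" and M: "M \<in> carrier_mat k p"
  shows "mnorm2 (W * M * V\<^sup>T + V * M\<^sup>T * W\<^sup>T) = mnorm2 M" (is "mnorm2 ?S = _")
proof (rule antisym)
  note carr = V(1) W(1) M
  have S: "?S *\<^sub>v v = V *\<^sub>v (M\<^sup>T *\<^sub>v (W\<^sup>T *\<^sub>v v)) + W *\<^sub>v (M *\<^sub>v (V\<^sup>T *\<^sub>v v))"
    if "v \<in> carrier_vec n" for v
  proof -
    have "?S *\<^sub>v v = W * M * V\<^sup>T *\<^sub>v v + V * M\<^sup>T * W\<^sup>T *\<^sub>v v"
      using that carr by (intro add_mult_distrib_mat_vec) auto
    also have "\<dots> = W *\<^sub>v (M *\<^sub>v (V\<^sup>T *\<^sub>v v)) + V *\<^sub>v (M\<^sup>T *\<^sub>v (W\<^sup>T *\<^sub>v v))"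
      using that carr
      by (simp add: assoc_mult_mat_vec[of _ n p _ n] assoc_mult_mat_vec[of _ n k _ n]
        assoc_mult_mat_vec[of _ n k _ p] assoc_mult_mat_vec[of _ n p _ k])
    also have "\<dots> = V *\<^sub>v (M\<^sup>T *\<^sub>v (W\<^sup>T *\<^sub>v v)) + W *\<^sub>v (M *\<^sub>v (V\<^sup>T *\<^sub>v v))"
      using that carr by (intro comm_add_vec[of _ n]) auto
    finally show ?thesis .
  qed
  have norm_S: "(vnorm2 (?S *\<^sub>v v))\<^sup>2
      = (vnorm2 (M\<^sup>T *\<^sub>v (W\<^sup>T *\<^sub>v v)))\<^sup>2 + (vnorm2 (M *\<^sub>v (V\<^sup>T *\<^sub>v v)))\<^sup>2"
    if "v \<in> carrier_vec n" for v
    unfolding S[OF that] vnorm2_power2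
    using that carr by (intro scalar_prod_orthonormal[OF V W WV]) auto
  show "mnorm2 ?S \<le> mnorm2 M"
  proof (rule mnorm2_le)
    fix v assume v: "v \<in> carrier_vec (dim_col ?S)" and v1: "vnorm2 v \<le> 1"
    have v: "v \<in> carrier_vec n" using v W by simp
    let ?a = "V\<^sup>T *\<^sub>v v" and ?b = "W\<^sup>T *\<^sub>v v"
    have a: "?a \<in> carrier_vec p" and b: "?b \<in> carrier_vec k" using v V W by auto
    \<comment> \<open>The orthogonal projection of \<open>v\<close> onto the sum of the two ranges.
      Since \<open>?x \<bullet> v = ?x \<bullet> ?x\<close>, expanding the square of
      \<open>v - ?x\<close> gives Bessel's inequality.\<close>
    let ?x = "V *\<^sub>v ?a + W *\<^sub>v ?b"
    have x: "?x \<in> carrier_vec n" using V W v by auto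
    have xx: "?x \<bullet> ?x = ?a \<bullet> ?a + ?b \<bullet> ?b"
      by (rule scalar_prod_orthonormal[OF V W WV a b])
    have Va: "(V *\<^sub>v ?a) \<bullet> v = ?a \<bullet> ?a"
      using transpose_vec_mult_scalar[OF V(1) a v] V v a
      by (simp add: comm_scalar_prod[of v n])
    have Wb: "(W *\<^sub>v ?b) \<bullet> v = ?b \<bullet> ?b"
      using transpose_vec_mult_scalar[OF W(1) b v] W v b
      by (simp add: comm_scalar_prod[of v n])
    have xv: "?x \<bullet> v = ?x \<bullet> ?x"
      unfolding xx using Va Wb V W v by (simp add: add_scalar_prod_distrib[of _ n])
    have "0 \<le> (v - ?x) \<bullet> (v - ?x)" by (metis vnorm2_power2 zero_le_power2)
    also have "\<dots> = v \<bullet> v - ?x \<bullet> ?x"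
      using x v xv comm_scalar_prod[OF v x]
      by (simp add: minus_scalar_prod_distrib[of _ n] scalar_prod_minus_distrib[of _ n])
    also have "\<dots> \<le> 1 - ?x \<bullet> ?x"
      using v1 power_mono[OF v1, of 2] by (simp add: vnorm2_power2)
    finally have bessel: "(vnorm2 ?a)\<^sup>2 + (vnorm2 ?b)\<^sup>2 \<le> 1"
      unfolding xx vnorm2_power2 by simp
    have "(vnorm2 (?S *\<^sub>v v))\<^sup>2 \<le> (mnorm2 M * vnorm2 ?b)\<^sup>2 + (mnorm2 M * vnorm2 ?a)\<^sup>2"
      unfolding norm_S[OF v] using a b M
      by (intro add_mono power_mono vnorm2_mult_transpose_le vnorm2_mult_mat_vec_le) auto
    also have "\<dots> = (mnorm2 M)\<^sup>2 * ((vnorm2 ?a)\<^sup>2 + (vnorm2 ?b)\<^sup>2)"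
      by (simp add: power_mult_distrib algebra_simps)
    also have "\<dots> \<le> (mnorm2 M)\<^sup>2 * 1"
      using bessel by (intro mult_left_mono) auto
    finally have "(vnorm2 (?S *\<^sub>v v))\<^sup>2 \<le> (mnorm2 M)\<^sup>2"
      by (simp only: mult_1_right)
    then show "vnorm2 (?S *\<^sub>v v) \<le> mnorm2 M"
      by (rule power2_le_imp_le[OF _ mnorm2_nonneg])
  qed
  show "mnorm2 M \<le> mnorm2 ?S"
  proof (rule mnorm2_le)
    fix a assume a: "a \<in> carrier_vec (dim_col M)" and a1: "vnorm2 a \<le> 1"
    have a: "a \<in> carrier_vec p" using a M by simp
    have Va: "V *\<^sub>v a \<in> carrier_vec n" using V a by auto
    have VVa: "V\<^sup>T *\<^sub>v (V *\<^sub>v a) = a"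
      using assoc_mult_mat_vec[of "V\<^sup>T" p n V p a] V a by simp
    have "vnorm2 (V *\<^sub>v a) = vnorm2 a"
      using transpose_vec_mult_scalar[OF V(1) a Va] VVa
      by (simp add: vnorm2_def)
    then have "vnorm2 (?S *\<^sub>v (V *\<^sub>v a)) \<le> mnorm2 ?S"
      using Va a1 W by (intro vnorm2_le_mnorm2) auto
    moreover have "(vnorm2 (M *\<^sub>v a))\<^sup>2 \<le> (vnorm2 (?S *\<^sub>v (V *\<^sub>v a)))\<^sup>2"
      unfolding norm_S[OF Va] VVa by simp
    ultimately show "vnorm2 (M *\<^sub>v a) \<le> mnorm2 ?S"
      by (rule order_trans[OF power2_le_imp_le[OF _ vnorm2_nonneg], rotated])
  qed
qed

subsection \<open>Derivatives, ranks and block matrices\<close>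

text \<open>Each entry of \<open>L * Y t * N\<close> is a fixed linear combination of the entries of
  \<open>Y t\<close>, so differentiation commutes with constant factors on both sides.\<close>

lemma mat_deriv_mult:
  assumes T: "0 < T" and t: "t \<in> {0..T}"
    and Y: "mat_differentiable_on Y p q {0..T}"
    and L: "L \<in> carrier_mat r p" and N: "N \<in> carrier_mat q c"
    and X: "\<And>t. t \<in> {0..T} \<Longrightarrow> X t = L * Y t * N"
  shows "mat_deriv {0..T} X t = L * mat_deriv {0..T} Y t * N"
proof -
  have Yc: "Y u \<in> carrier_mat p q" if "u \<in> {0..T}" for u
    using Y that by (simp add: mat_differentiable_on_def)
  have Yd: "((\<lambda>u. Y u $$ (i, j)) has_vector_derivative mat_deriv {0..T} Y t $$ (i, j)) (at t within {0..T})"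
    if "i < p" "j < q" for i j
  proof -
    have "(\<lambda>u. Y u $$ (i, j)) differentiable at t within {0..T}"
      using Y t that by (auto simp: mat_differentiable_on_def differentiable_on_def)
    then show ?thesis
      using that Yc[OF t] by (simp add: mat_deriv_def vector_derivative_works)
  qed
  have D: "mat_deriv {0..T} Y t \<in> carrier_mat p q"
    using Yc[OF t] by (auto simp: mat_deriv_def)
  have entry: "(L * Z * N) $$ (i, j) = (\<Sum>b<q. (\<Sum>a<p. L $$ (i, a) * Z $$ (a, b)) * N $$ (b, j))"
    if "Z \<in> carrier_mat p q" "i < r" "j < c" for Z i j
    using that L N by (simp add: scalar_prod_def atLeast0LessThan del: assoc_mult_mat)
  show ?thesis
  proof (rule eq_matI)
    fix i j assume "i < dim_row (L * mat_deriv {0..T} Y t * N)" "j < dim_col (L * mat_deriv {0..T} Y t * N)"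
    then have i: "i < r" and j: "j < c" using L N by auto
    have "((\<lambda>u. \<Sum>b<q. (\<Sum>a<p. L $$ (i, a) * Y u $$ (a, b)) * N $$ (b, j)) has_vector_derivative
        (L * mat_deriv {0..T} Y t * N) $$ (i, j)) (at t within {0..T})"
      unfolding entry[OF D i j]
      by (intro has_vector_derivative_sum has_vector_derivative_mult_left
        has_vector_derivative_mult_right Yd) auto
    then have "((\<lambda>u. X u $$ (i, j)) has_vector_derivative (L * mat_deriv {0..T} Y t * N) $$ (i, j))
        (at t within {0..T})"
      by (rule has_vector_derivative_transform[OF t, rotated]) (simp only: X entry[OF Yc i j])
    \<comment> \<open>As \<open>0 < T\<close>, one-sided derivatives at the endpoints are unique
      too, so \<open>vector_derivative\<close> returns the value just found.\<close>
    then show "mat_deriv {0..T} X t $$ (i, j) = (L * mat_deriv {0..T} Y t * N) $$ (i, j)"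
      using vector_derivative_within_closed_interval[OF T t] i j L N
      by (simp add: mat_deriv_def X[OF t])
  qed (use L N in \<open>simp_all add: mat_deriv_def X[OF t]\<close>)
qed

section \<open>Rank and invertibility\<close>

lemma (in vec_space) rank_le_card_cols:
  assumes "A \<in> carrier_mat n nc"
  shows "rank A \<le> card (set (cols A))"
proof -
  obtain S where S: "maximal S (\<lambda>T. T \<subseteq> set (cols A) \<and> lin_indpt T)"
    using maximal_exists_superset[of "set (cols A)" "\<lambda>T. T \<subseteq> set (cols A) \<and> lin_indpt T" "{}"]
    by (metis (no_types, lifting) List.finite_set empty_subsetI finite.emptyI finite_lin_indpt2 empty_iff)
  then have "card S \<le> card (set (cols A))" by (simp add: card_mono maximal_def)
  then show ?thesis using rank_card_indpt[OF assms S] by simp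
qed

text \<open>Linear independence is a property of the set of columns, so repetitions have to be
  excluded first: the rank is at most the number of distinct columns, hence full rank forces all
  columns to differ.\<close>

lemma (in vec_space) full_col_rank_imp_inj:
  assumes A: "A \<in> carrier_mat n nc" "rank A = nc"
    and v: "v \<in> carrier_vec nc" "A *\<^sub>v v = 0\<^sub>v n"
  shows "v = 0\<^sub>v nc"
proof (rule ccontr)
  assume "v \<noteq> 0\<^sub>v nc"
  have "length (cols A) \<le> card (set (cols A))" using rank_le_card_cols[OF A(1)] A by simp
  then have d: "distinct (cols A)" by (metis card_distinct card_length le_antisym)
  show False
    using full_rank_lin_indpt[OF A d] lin_depI[OF A(1) v(1) \<open>v \<noteq> 0\<^sub>v nc\<close> v(2) d] by simp
qed

lemma right_inverse_of_det:
  assumes R: "(R :: real mat) \<in> carrier_mat k k" "det R \<noteq> 0"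
  obtains S where "S \<in> carrier_mat k k" "R * S = 1\<^sub>m k"
  using det_non_zero_imp_unit[OF R, of undefined] by (auto simp: Units_def ring_mat_def)

lemma right_inverse_of_full_rank:
  assumes R: "R \<in> carrier_mat k k" "full_rank R"
  obtains S where "S \<in> carrier_mat k k" "R * S = 1\<^sub>m k"
  using assms right_inverse_of_det[OF R(1)] vec_space.det_rank_iff[OF R(1)]
  by (auto simp: full_rank_def mrank_def)

text \<open>A kernel vector of \<open>R\<close> is one of \<open>Q * R\<close>. This serves for the
  initial factor \<Lambda>, where absence of breakdown is a condition on the product and not on the
  triangular factor.\<close>

lemma right_inverse_of_full_rank_factor:
  assumes Q: "Q \<in> carrier_mat n k" and R: "R \<in> carrier_mat k k" and rank: "mrank (Q * R) = k"
  obtains S where "S \<in> carrier_mat k k" "R * S = 1\<^sub>m k"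
proof (rule right_inverse_of_det[OF R])
  show "det R \<noteq> 0"
  proof
    assume "det R = 0"
    then obtain v where v: "v \<in> carrier_vec k" "v \<noteq> 0\<^sub>v k" "R *\<^sub>v v = 0\<^sub>v k"
      using det_0_iff_vec_prod_zero_field[OF R] by auto
    have "Q * R *\<^sub>v v = Q *\<^sub>v 0\<^sub>v k"
      using assoc_mult_mat_vec[OF Q R v(1)] v(3) by simp
    also have "\<dots> = 0\<^sub>v n" using Q by (intro eq_vecI) auto
    finally have "v = 0\<^sub>v k"
      using vec_space.full_col_rank_imp_inj[of "Q * R" n k v] Q R rank v by (simp add: mrank_def)
    then show False using v by simp
  qed
qed (rule that)

lemma right_cancel:
  assumes D: "(D :: real mat) \<in> carrier_mat n k" and R: "R \<in> carrier_mat k k"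
    and S: "S \<in> carrier_mat k k" "R * S = 1\<^sub>m k" and "D * R = 0\<^sub>m n k"
  shows "D = 0\<^sub>m n k"
proof -
  have "D = D * R * S" using assoc_mult_mat[OF D R S(1)] S(2) D by simp
  then show ?thesis using assms by simp
qed

text \<open>\<open>mat_inverse\<close> is specified through the units of the matrix ring;
  translating \<open>invertible_mat\<close> into these terms shows that \<open>the\<close> in
  \<open>inv_mat\<close> is applied to a \<open>Some\<close>.\<close>

lemma inv_mat_props:
  assumes F: "F \<in> carrier_mat n n" "invertible_mat F"
  shows "inv_mat F \<in> carrier_mat n n" "F * inv_mat F = 1\<^sub>m n"
proof -
  obtain B where B: "F * B = 1\<^sub>m n" "B * F = 1\<^sub>m (dim_row B)"
    using F by (auto simp: invertible_mat_def inverts_mat_def)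
  have "dim_col B = n" using arg_cong[OF B(1), of dim_col] by simp
  moreover have "dim_row B = n" using arg_cong[OF B(2), of dim_col] F by simp
  ultimately have "F \<in> Units (ring_mat TYPE(real) n ())"
    using B F by (auto simp: Units_def ring_mat_def)
  then obtain B' where "mat_inverse F = Some B'"
    using mat_inverse(1)[OF F(1), where b = "()"] by (cases "mat_inverse F") auto
  then show "inv_mat F \<in> carrier_mat n n" "F * inv_mat F = 1\<^sub>m n"
    using mat_inverse(2)[OF F(1)] by (auto simp: inv_mat_def)
qed

lemma invertible_mat_transpose:
  assumes "invertible_mat (F :: real mat)"
  shows "invertible_mat F\<^sup>T"
proof -
  obtain B where B: "square_mat F" "F * B = 1\<^sub>m (dim_row F)" "B * F = 1\<^sub>m (dim_row B)"
    using assms by (auto simp: invertible_mat_def inverts_mat_def)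
  have "dim_col B = dim_row F" using arg_cong[OF B(2), of dim_col] by simp
  moreover have "dim_row B = dim_col F" using arg_cong[OF B(3), of dim_col] by simp
  ultimately have "F\<^sup>T * B\<^sup>T = 1\<^sub>m (dim_col F)" "B\<^sup>T * F\<^sup>T = 1\<^sub>m (dim_row F)"
    using B by (simp_all flip: transpose_mult_dim)
  then show ?thesis
    using B(1) \<open>dim_col B = dim_row F\<close> by (auto simp: invertible_mat_def inverts_mat_def intro!: exI[of _ "B\<^sup>T"])
qed

section \<open>Matrices assembled from blocks of columns\<close>

lemma append_cols_dim [simp]:
  "dim_row (append_cols M N) = dim_row M"
  "dim_col (append_cols M N) = dim_col M + dim_col N"
  if "dim_row M = dim_row N"
  using that by (simp_all add: append_cols_def append_rows_def)

lemma append_cols_index: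
  assumes "dim_row M = dim_row N" "i < dim_row M" "j < dim_col M + dim_col N"
  shows "append_cols M N $$ (i, j) = (if j < dim_col M then M $$ (i, j) else N $$ (i, j - dim_col M))"
  using assms by (auto simp: append_cols_def append_rows_def)

lemma first_cols_dim [simp]: "dim_row (first_cols k M) = dim_row M" "dim_col (first_cols k M) = k"
  by (simp_all add: first_cols_def)

lemma last_cols_dim [simp]: "dim_row (last_cols k M) = dim_row M" "dim_col (last_cols k M) = k"
  by (simp_all add: last_cols_def)

lemma last_rows_dim [simp]: "dim_row (last_rows k M) = k" "dim_col (last_rows k M) = dim_col M"
  by (simp_all add: last_rows_def)

lemma first_cols_append:
  "dim_row M = dim_row N \<Longrightarrow> first_cols (dim_col M) (append_cols M N) = M"
  by (rule eq_matI) (auto simp: first_cols_def append_cols_index)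

lemma last_cols_append:
  "dim_row M = dim_row N \<Longrightarrow> last_cols (dim_col N) (append_cols M N) = N"
  by (rule eq_matI) (auto simp: last_cols_def append_cols_index)

lemma first_cols_mult:
  assumes "dim_col M = dim_row N" "k \<le> dim_col N"
  shows "first_cols k (M * N) = M * first_cols k N"
proof (rule eq_matI)
  fix i j assume ij: "i < dim_row (M * first_cols k N)" "j < dim_col (M * first_cols k N)"
  then have "col (first_cols k N) j = col N j"
    using assms by (intro eq_vecI) (auto simp: first_cols_def)
  then show "first_cols k (M * N) $$ (i, j) = (M * first_cols k N) $$ (i, j)"
    using ij assms by (simp add: first_cols_def)
qed simp_all

lemma last_cols_mult:
  assumes "dim_col M = dim_row N" "k \<le> dim_col N"
  shows "last_cols k (M * N) = M * last_cols k N"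
proof (rule eq_matI)
  fix i j assume ij: "i < dim_row (M * last_cols k N)" "j < dim_col (M * last_cols k N)"
  then have "col (last_cols k N) j = col N (dim_col N - k + j)"
    using assms by (intro eq_vecI) (auto simp: last_cols_def)
  then show "last_cols k (M * N) $$ (i, j) = (M * last_cols k N) $$ (i, j)"
    using ij assms by (simp add: last_cols_def)
qed simp_all

lemma last_cols_diff:
  assumes "dim_row M = dim_row N" "dim_col M = dim_col N" "k \<le> dim_col N"
  shows "last_cols k (M - N) = last_cols k M - last_cols k N"
  using assms by (intro eq_matI) (auto simp: last_cols_def)

text \<open>Block multiplication: the sum over the inner index splits at \<open>dim_col M\<close>.
  This is how \<open>last_rows\<close> of \<open>Y\<close> enters the residual.\<close>

lemma append_cols_mult:
  assumes "dim_row M = dim_row N" "dim_row Y = dim_col M + dim_col N"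
  shows "append_cols M N * Y
    = M * mat (dim_col M) (dim_col Y) (\<lambda>(i, j). Y $$ (i, j)) + N * last_rows (dim_col N) Y"
proof (rule eq_matI, goal_cases)
  case (1 i j)
  let ?p = "dim_col M" and ?q = "dim_col N"
  have "(append_cols M N * Y) $$ (i, j) = (\<Sum>a\<in>{0..<?p + ?q}. append_cols M N $$ (i, a) * Y $$ (a, j))"
    using 1 assms by (simp add: scalar_prod_def)
  also have "\<dots> = (\<Sum>a\<in>{0..<?p}. append_cols M N $$ (i, a) * Y $$ (a, j))
      + (\<Sum>a\<in>{?p..<?p + ?q}. append_cols M N $$ (i, a) * Y $$ (a, j))"
    by (simp add: sum.atLeastLessThan_concat)
  also have "(\<Sum>a\<in>{?p..<?p + ?q}. append_cols M N $$ (i, a) * Y $$ (a, j))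
      = (\<Sum>a\<in>{0..<?q}. append_cols M N $$ (i, ?p + a) * Y $$ (?p + a, j))"
    using sum.shift_bounds_nat_ivl[of "\<lambda>a. append_cols M N $$ (i, a) * Y $$ (a, j)" 0 ?p ?q]
    by (simp add: add.commute)
  finally show ?case
    using 1 assms by (simp add: scalar_prod_def append_cols_index last_rows_def)
qed (use assms in simp_all)

lemma append_cols_mult_transpose:
  assumes "dim_row M = dim_row N"
  shows "append_cols M N * (append_cols M N)\<^sup>T = M * M\<^sup>T + N * N\<^sup>T"
proof -
  have "mat (dim_col M) (dim_row M) (\<lambda>(i, j). (append_cols M N)\<^sup>T $$ (i, j)) = M\<^sup>T"
    using assms by (intro eq_matI) (auto simp: append_cols_index)
  moreover have "last_rows (dim_col N) (append_cols M N)\<^sup>T = N\<^sup>T"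
    using assms by (intro eq_matI) (auto simp: append_cols_index last_rows_def)
  ultimately show ?thesis using assms by (simp add: append_cols_mult)
qed

text \<open>Column \<open>j\<close> of \<open>D * R\<close> involves only the columns \<open>0, \<dots>, j\<close> of \<open>D\<close>.\<close>

lemma mult_upper_triangular_eq_0:
  assumes D: "D \<in> carrier_mat n (s + s)" and R: "R \<in> carrier_mat (s + s) (s + s)" "upper_triangular R"
    and first: "first_cols s D = 0\<^sub>m n s" and last: "last_cols s (D * R) = 0\<^sub>m n s"
  shows "D * R = (0\<^sub>m n (s + s) :: real mat)"
proof (rule eq_matI)
  fix i j assume "i < dim_row (0\<^sub>m n (s + s) :: real mat)" "j < dim_col (0\<^sub>m n (s + s) :: real mat)"
  then have i: "i < n" and j: "j < s + s" by auto
  show "(D * R) $$ (i, j) = 0\<^sub>m n (s + s) $$ (i, j)"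
  proof (cases "j < s")
    case True
    have "D $$ (i, a) * R $$ (a, j) = 0" if "a < s + s" for a
    proof (cases "a \<le> j")
      case True
      then have "first_cols s D $$ (i, a) = 0" using \<open>j < s\<close> i unfolding first by simp
      then show ?thesis using True \<open>j < s\<close> i D by (simp add: first_cols_def)
    next
      case False
      then show ?thesis using upper_triangularD[OF R(2), of j a] that R by simp
    qed
    then show ?thesis using i j D R by (auto simp: scalar_prod_def intro!: sum.neutral)
  next
    case False
    then have "last_cols s (D * R) $$ (i, j - s) = 0" unfolding last using i j by simp
    then show ?thesis using False i j D R by (simp add: last_cols_def)
  qed
qed (use D R in auto)

lemma concat_blocks_dim [simp]:
  "dim_row (concat_blocks n k m V) = n" "dim_col (concat_blocks n k m V) = m * k"
  by (simp_all add: concat_blocks_def)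

lemma concat_blocks_Suc:
  assumes "V (Suc j) \<in> carrier_mat n k"
  shows "concat_blocks n k (Suc j) V = append_cols (concat_blocks n k j V) (V (Suc j))"
proof (rule eq_matI, goal_cases)
  case (1 i a)
  then have a: "i < n" "a < j * k + k" using assms by auto
  show ?case
  proof (cases "a < j * k")
    case True
    then show ?thesis using a assms by (simp add: append_cols_index concat_blocks_def)
  next
    case False
    then obtain b where b: "a = j * k + b" by (metis le_iff_add not_less)
    then have "b < k" using a by simp
    then show ?thesis using a b assms by (simp add: append_cols_index concat_blocks_def)
  qed
qed (use assms in auto)

text \<open>Columns are counted from 0 but blocks from 1, hence the shift of the quotient by
  one.\<close>

lemma col_concat_blocks:
  assumes "a < m * k" "\<And>i. i \<in> {1..m} \<Longrightarrow> V i \<in> carrier_mat n k"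
  shows "col (concat_blocks n k m V) a = col (V (a div k + 1)) (a mod k)"
    and "a div k + 1 \<in> {1..m}" and "a mod k < k"
proof -
  show "a div k + 1 \<in> {1..m}" using assms(1) by (auto simp: less_mult_imp_div_less Suc_le_eq)
  moreover have "k > 0" using assms(1) by (cases k) auto
  ultimately show "col (concat_blocks n k m V) a = col (V (a div k + 1)) (a mod k)" "a mod k < k"
    using assms(1) assms(2)[of "a div k + 1"] by (auto intro!: eq_vecI simp: concat_blocks_def)
qed

lemma mult_concat_blocks:
  assumes "\<And>i. i \<in> {1..m} \<Longrightarrow> V i \<in> carrier_mat n k" "dim_col M = n"
  shows "M * concat_blocks n k m V = concat_blocks (dim_row M) k m (\<lambda>i. M * V i)"
proof (rule eq_matI, goal_cases)
  case (1 i a)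
  then have a: "i < dim_row M" "a < m * k" by auto
  note col_a = col_concat_blocks[of a m k V n, OF a(2) assms(1)]
  have "(M * concat_blocks n k m V) $$ (i, a) = row M i \<bullet> col (V (a div k + 1)) (a mod k)"
    using a col_a(1) by simp
  also have "\<dots> = (M * V (a div k + 1)) $$ (i, a mod k)"
    using a col_a(3) assms(1)[OF col_a(2)] by simp
  finally show ?case
    using a by (simp add: concat_blocks_def[of "dim_row M"])
qed (use assms in auto)

subsection \<open>Orthonormal blocks and their projections\<close>

definition orthonormal_blocks :: "nat \<Rightarrow> nat \<Rightarrow> nat \<Rightarrow> (nat \<Rightarrow> real mat) \<Rightarrow> bool" where
  "orthonormal_blocks n k j V \<longleftrightarrow> (\<forall>p\<in>{1..j}. V p \<in> carrier_mat n k) \<and>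
     (\<forall>p\<in>{1..j}. \<forall>q\<in>{1..j}. (V p)\<^sup>T * V q = (if p = q then 1\<^sub>m k else 0\<^sub>m k k))"

text \<open>For orthonormal blocks, this is the orthogonal projection onto the span of \<open>V 1, \<dots>, V j\<close>.\<close>

primrec block_proj :: "nat \<Rightarrow> (nat \<Rightarrow> real mat) \<Rightarrow> nat \<Rightarrow> real mat" where
  "block_proj n V 0 = 0\<^sub>m n n"
| "block_proj n V (Suc j) = block_proj n V j + V (Suc j) * (V (Suc j))\<^sup>T"

declare block_proj.simps(2) [simp del]

lemma orthonormal_blocksD:
  assumes "orthonormal_blocks n k j V" "p \<in> {1..j}"
  shows "V p \<in> carrier_mat n k" "dim_row (V p) = n" "dim_col (V p) = k"
    "\<And>q. q \<in> {1..j} \<Longrightarrow> (V p)\<^sup>T * V q = (if p = q then 1\<^sub>m k else 0\<^sub>m k k)"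
  using assms by (auto simp: orthonormal_blocks_def)

lemma orthonormal_blocks_mono:
  "orthonormal_blocks n k j V \<Longrightarrow> i \<le> j \<Longrightarrow> orthonormal_blocks n k i V"
  by (auto simp: orthonormal_blocks_def)

lemma block_proj_dim:
  assumes "orthonormal_blocks n k j V" "i \<le> j"
  shows "dim_row (block_proj n V i) = n" "dim_col (block_proj n V i) = n"
  using assms(2) orthonormal_blocksD(2)[OF assms(1)] by (induction i) (auto simp: block_proj.simps(2))

lemma block_proj_sym:
  assumes "orthonormal_blocks n k j V" "i \<le> j"
  shows "(block_proj n V i)\<^sup>T = block_proj n V i"
  using assms(2)
proof (induction i)
  case (Suc i)
  then show ?case
    using orthonormal_blocksD(2)[OF assms(1), of "Suc i"] block_proj_dim[OF assms(1), of i]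
    by (simp add: block_proj.simps(2) transpose_add_dim transpose_mult_dim)
qed auto

lemma block_proj_mult_block:
  assumes V: "orthonormal_blocks n k j V" and i: "i \<le> j" and p: "p \<in> {1..j}"
  shows "block_proj n V i * V p = (if p \<le> i then V p else 0\<^sub>m n k)"
  using i
proof (induction i)
  case 0
  then show ?case using p orthonormal_blocksD[OF V p] by auto
next
  case (Suc i)
  have S: "Suc i \<in> {1..j}" using Suc.prems by simp
  have "block_proj n V (Suc i) * V p = block_proj n V i * V p + V (Suc i) * ((V (Suc i))\<^sup>T * V p)"
    using orthonormal_blocksD[OF V p] orthonormal_blocksD[OF V S] Suc.prems block_proj_dim[OF V, of i]
    by (simp add: block_proj.simps(2) mat_dim_simps)
  then show ?case
    using Suc orthonormal_blocksD(1)[OF V p] orthonormal_blocksD(1)[OF V S]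
      orthonormal_blocksD(4)[OF V S p]
    by (auto simp: le_Suc_eq)
qed

text \<open>The ranges are nested; the case \<open>i = i'\<close> is idempotence.\<close>

lemma block_proj_mult_block_proj:
  assumes V: "orthonormal_blocks n k j V" and "i \<le> i'" "i' \<le> j"
  shows "block_proj n V i' * block_proj n V i = block_proj n V i"
  using assms(2)
proof (induction i)
  case 0
  then show ?case using block_proj_dim[OF V assms(3)] by (simp add: mat_dim_simps)
next
  case (Suc i)
  have S: "Suc i \<in> {1..j}" using Suc.prems assms by simp
  have "block_proj n V i' * block_proj n V (Suc i)
      = block_proj n V i' * block_proj n V i + block_proj n V i' * V (Suc i) * (V (Suc i))\<^sup>T"
    using orthonormal_blocksD[OF V S] block_proj_dim[OF V, of i] block_proj_dim[OF V assms(3)] S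
    by (simp add: block_proj.simps(2) mat_dim_simps)
  then show ?case
    using Suc block_proj_mult_block[OF V assms(3) S] by (simp add: block_proj.simps(2))
qed

text \<open>Being fixed by the projection encodes that the columns of \<open>M\<close> lie in the
  span of the first blocks, so membership in a span becomes a matrix equation.\<close>

lemma block_proj_fixed_mono:
  assumes V: "orthonormal_blocks n k j V" and "i \<le> i'" "i' \<le> j"
    and M: "dim_row M = n" "block_proj n V i * M = M"
  shows "block_proj n V i' * M = M"
proof -
  have "block_proj n V i' * (block_proj n V i * M) = block_proj n V i' * block_proj n V i * M"
    using block_proj_dim[OF V, of i] block_proj_dim[OF V, of i'] assms by (simp add: mult_assoc_dim)
  then show ?thesis using block_proj_mult_block_proj[OF V assms(2,3)] M(2) by simp
qed

lemma transpose_block_mult_proj: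
  assumes V: "orthonormal_blocks n k j V" and i: "i \<le> j" and p: "p \<in> {1..j}"
  shows "(V p)\<^sup>T * block_proj n V i = (if p \<le> i then (V p)\<^sup>T else 0\<^sub>m k n)"
proof -
  have "(V p)\<^sup>T * block_proj n V i = (block_proj n V i * V p)\<^sup>T"
    using block_proj_dim[OF V i] block_proj_sym[OF V i] orthonormal_blocksD[OF V p]
    by (simp add: transpose_mult_dim)
  then show ?thesis unfolding block_proj_mult_block[OF assms] by simp
qed

text \<open>Modified and classical Gram-Schmidt agree here: what was subtracted earlier is
  orthogonal to the next block, so the coefficient computed from \<open>W i\<close> equals the one
  computed from \<open>W 0\<close>.\<close>

lemma gram_schmidt_sweep:
  assumes V: "orthonormal_blocks n k j V" and W0: "dim_row (W 0) = n"
    and W: "\<And>i. i \<in> {1..j} \<Longrightarrow> W i = W (i - 1) - V i * ((V i)\<^sup>T * W (i - 1))"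
    and "i \<le> j"
  shows "W i = W 0 - block_proj n V i * W 0"
  using \<open>i \<le> j\<close>
proof (induction i)
  case 0
  then show ?case using W0 by (simp add: mat_dim_simps) (rule eq_matI, auto)
next
  case (Suc i)
  have S: "Suc i \<in> {1..j}" using Suc.prems by simp
  note dims = orthonormal_blocksD(2,3)[OF V S] block_proj_dim[OF V, of i] W0
  have i: "i \<le> j" using Suc.prems by simp
  have "(V (Suc i))\<^sup>T * (block_proj n V i * W 0) = 0\<^sub>m k (dim_col (W 0))"
    using transpose_block_mult_proj[OF V i S] dims i
    by (simp add: mat_dim_simps flip: mult_assoc_dim)
  then have "(V (Suc i))\<^sup>T * W i = (V (Suc i))\<^sup>T * W 0"
    using Suc.IH[OF i] dims i by (simp add: mat_dim_simps) (rule eq_matI, auto)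
  then have "W (Suc i) = W 0 - block_proj n V i * W 0 - V (Suc i) * ((V (Suc i))\<^sup>T * W 0)"
    using W[OF S] Suc.IH[OF i] by simp
  also have "\<dots> = W 0 - (block_proj n V i * W 0 + V (Suc i) * ((V (Suc i))\<^sup>T * W 0))"
    using dims i by (intro eq_matI) auto
  also have "\<dots> = W 0 - block_proj n V (Suc i) * W 0"
    using dims i by (simp add: block_proj.simps(2) mat_dim_simps)
  finally show ?case .
qed

text \<open>Orthogonality to the whole span passes to each block because
  \<open>(V p)\<^sup>T\<close> absorbs the projection.\<close>

lemma orthonormal_blocks_Suc:
  assumes V: "orthonormal_blocks n k j V"
    and Q: "V (Suc j) \<in> carrier_mat n k" "(V (Suc j))\<^sup>T * V (Suc j) = 1\<^sub>m k"
    and orth: "block_proj n V j * V (Suc j) = 0\<^sub>m n k"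
  shows "orthonormal_blocks n k (Suc j) V"
proof -
  have 1: "(V p)\<^sup>T * V (Suc j) = 0\<^sub>m k k" if p: "p \<in> {1..j}" for p
  proof -
    have "(V p)\<^sup>T * V (Suc j) = (V p)\<^sup>T * block_proj n V j * V (Suc j)"
      using transpose_block_mult_proj[OF V order_refl p] p by simp
    also have "\<dots> = (V p)\<^sup>T * (block_proj n V j * V (Suc j))"
      using orthonormal_blocksD[OF V p] Q block_proj_dim[OF V order_refl]
      by (simp add: mult_assoc_dim)
    finally show ?thesis using orth orthonormal_blocksD[OF V p] by (simp add: mat_dim_simps)
  qed
  have 2: "(V (Suc j))\<^sup>T * V p = 0\<^sub>m k k" if p: "p \<in> {1..j}" for p
    using arg_cong[OF 1[OF p], of transpose_mat] orthonormal_blocksD[OF V p] Q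
    by (simp add: transpose_mult_dim)
  show ?thesis
    using 1 2 Q V by (auto simp: orthonormal_blocks_def atLeastAtMostSuc_conv)
qed

lemma concat_blocks_mult_transpose:
  assumes V: "orthonormal_blocks n k j V" and "i \<le> j"
  shows "concat_blocks n k i V * (concat_blocks n k i V)\<^sup>T = block_proj n V i"
  using assms(2)
proof (induction i)
  case 0
  then show ?case by (intro eq_matI) (auto simp: scalar_prod_def)
next
  case (Suc i)
  then have "V (Suc i) \<in> carrier_mat n k" using orthonormal_blocksD(1)[OF V] by simp
  then show ?case using Suc by (simp add: concat_blocks_Suc append_cols_mult_transpose block_proj.simps(2))
qed

lemma transpose_concat_blocks_mult:
  assumes V: "orthonormal_blocks n k m V"
  shows "(concat_blocks n k m V)\<^sup>T * concat_blocks n k m V = 1\<^sub>m (m * k)"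
proof (rule eq_matI, goal_cases)
  case (1 a b)
  then have ab: "a < m * k" "b < m * k" by auto
  note Vc = orthonormal_blocksD(1)[OF V]
  note ca = col_concat_blocks[of a m k V n, OF ab(1) Vc]
  note cb = col_concat_blocks[of b m k V n, OF ab(2) Vc]
  have "((concat_blocks n k m V)\<^sup>T * concat_blocks n k m V) $$ (a, b)
      = ((V (a div k + 1))\<^sup>T * V (b div k + 1)) $$ (a mod k, b mod k)"
    using ab ca cb Vc[OF ca(2)] Vc[OF cb(2)] by simp
  also have "\<dots> = (if a div k = b div k \<and> a mod k = b mod k then 1 else 0)"
    using orthonormal_blocksD(4)[OF V ca(2) cb(2)] ca(3) cb(3) by simp
  also have "a div k = b div k \<and> a mod k = b mod k \<longleftrightarrow> a = b"
    by (metis div_mult_mod_eq)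
  finally show ?case using ab by simp
qed simp_all

lemma concat_blocks_cong:
  assumes "\<And>i. i \<in> {1..m} \<Longrightarrow> V i = W i"
  shows "concat_blocks n k m V = concat_blocks n k m W"
  using assms by (intro eq_matI) (auto simp: concat_blocks_def less_mult_imp_div_less Suc_le_eq)

lemma concat_blocks_0:
  assumes "\<And>i. i \<in> {1..m} \<Longrightarrow> V i = 0\<^sub>m n k"
  shows "concat_blocks n k m V = 0\<^sub>m n (m * k)"
proof (rule eq_matI, goal_cases)
  case (1 i a)
  then have "a div k + 1 \<in> {1..m}" "k > 0"
    by (auto simp: less_mult_imp_div_less Suc_le_eq intro: Nat.gr0I)
  then show ?case using 1 assms by (simp add: concat_blocks_def)
qed simp_all

subsection \<open>The extended block Arnoldi process\<close>

text \<open>Collects the facts about the process alone, for a general pair \<open>(F, G)\<close>;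
  the Riccati equation enters only afterwards, with \<open>F = A\<^sup>T\<close> and
  \<open>G = C\<^sup>T\<close>.\<close>

locale extended_block_arnoldi =
  fixes F G :: "real mat" and n s m :: nat
    and V :: "nat \<Rightarrow> real mat" and \<Lambda> :: "real mat" and H :: "nat \<Rightarrow> nat \<Rightarrow> real mat"
  assumes F: "F \<in> carrier_mat n n" "invertible_mat F"
    and G: "G \<in> carrier_mat n s"
    and process: "eba_process F G s m V \<Lambda> H"
    and no_breakdown: "eba_no_breakdown F G m H"
begin

abbreviation P where "P \<equiv> block_proj n V"

lemma F_dim [simp]: "dim_row F = n" "dim_col F = n" "dim_row (inv_mat F) = n" "dim_col (inv_mat F) = n"
  using F(1) inv_mat_props(1)[OF F] by auto

lemma G_dim [simp]: "dim_row G = n" "dim_col G = s"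
  using G by auto

lemma F_mult_inv: "dim_row M = n \<Longrightarrow> F * (inv_mat F * M) = M"
  using inv_mat_props(2)[OF F] by (simp add: mult_one_dim flip: mult_assoc_dim)

lemma start_dim [simp]: "dim_row (eba_start F G) = n" "dim_col (eba_start F G) = 2 * s"
  by (simp_all add: eba_start_def)

lemma expand_dim [simp]:
  assumes "dim_row U = n"
  shows "dim_row (eba_expand F s U) = n" "dim_col (eba_expand F s U) = 2 * s"
  using assms by (simp_all add: eba_expand_def)

lemma first_block:
  "V 1 \<in> carrier_mat n (2 * s)" "(V 1)\<^sup>T * V 1 = 1\<^sub>m (2 * s)" "eba_start F G = V 1 * \<Lambda>"
  "\<Lambda> \<in> carrier_mat (2 * s) (2 * s)" "upper_triangular \<Lambda>"
  using process by (simp_all add: eba_process_def qr_decomp_def)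

text \<open>Orthonormality of the earlier blocks is a premise because the lemma is applied inside
  the induction that establishes it.\<close>

lemma gram_schmidt_step:
  assumes j: "j \<in> {1..m}" and V: "orthonormal_blocks n (2 * s) j V"
  shows "V (Suc j) \<in> carrier_mat n (2 * s)" "(V (Suc j))\<^sup>T * V (Suc j) = 1\<^sub>m (2 * s)"
    "H (Suc j) j \<in> carrier_mat (2 * s) (2 * s)" "upper_triangular (H (Suc j) j)"
    "V (Suc j) * H (Suc j) j = eba_expand F s (V j) - P j * eba_expand F s (V j)"
proof -
  have jj: "j \<in> {1..j}" using j by simp
  obtain W where W: "W 0 = eba_expand F s (V j)"
      "\<And>i. i \<in> {1..j} \<Longrightarrow> H i j = (V i)\<^sup>T * W (i - 1) \<and> W i = W (i - 1) - V i * H i j"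
      "qr_decomp (W j) (V (j + 1)) (H (j + 1) j)"
    using process j unfolding eba_process_def by metis
  have W0: "dim_row (W 0) = n" "dim_col (W 0) = 2 * s"
    using orthonormal_blocksD(2)[OF V jj] by (simp_all add: W(1))
  have Wj: "W j = W 0 - P j * W 0"
    using W(2) by (intro gram_schmidt_sweep[where W = W, OF V]) (auto simp: W0)
  then have "dim_row (W j) = n" "dim_col (W j) = 2 * s"
    using W0 block_proj_dim[OF V, of j] by simp_all
  then show "V (Suc j) \<in> carrier_mat n (2 * s)" "(V (Suc j))\<^sup>T * V (Suc j) = 1\<^sub>m (2 * s)"
    "H (Suc j) j \<in> carrier_mat (2 * s) (2 * s)" "upper_triangular (H (Suc j) j)"
    "V (Suc j) * H (Suc j) j = eba_expand F s (V j) - P j * eba_expand F s (V j)"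
    using W(3) Wj W(1) by (simp_all add: qr_decomp_def)
qed

lemma H_right_inverse:
  assumes j: "j \<in> {1..m}" and H: "H (Suc j) j \<in> carrier_mat (2 * s) (2 * s)"
  obtains S where "S \<in> carrier_mat (2 * s) (2 * s)" "H (Suc j) j * S = 1\<^sub>m (2 * s)"
  using right_inverse_of_full_rank[OF H] no_breakdown j by (auto simp: eba_no_breakdown_def)

text \<open>The projection \<open>P\<close> onto the earlier blocks annihilates
  \<open>(I - P) E\<close>, which is the new block times its triangular factor; that factor has a
  right inverse and can be removed. The index \<open>Suc j\<close> makes the result reach
  \<open>V (m + 1)\<close>.\<close>

lemma orthonormal_blocks_prefix:
  "j \<le> m \<Longrightarrow> orthonormal_blocks n (2 * s) (Suc j) V"
proof (induction j)
  case 0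
  then show ?case using first_block by (simp add: orthonormal_blocks_def)
next
  case (Suc j)
  let ?j = "Suc j"
  have V: "orthonormal_blocks n (2 * s) ?j V" using Suc by simp
  have j: "?j \<in> {1..m}" "?j \<in> {1..?j}" using Suc.prems by auto
  note st = gram_schmidt_step[OF j(1) V]
  note dims = block_proj_dim[OF V order_refl] orthonormal_blocksD(2)[OF V j(2)]
  let ?E = "eba_expand F s (V ?j)"
  obtain S where S: "S \<in> carrier_mat (2 * s) (2 * s)" "H (Suc ?j) ?j * S = 1\<^sub>m (2 * s)"
    using H_right_inverse[OF j(1) st(3)] .
  have "P ?j * V (Suc ?j) * H (Suc ?j) ?j = P ?j * (?E - P ?j * ?E)"
    using st(1,3) dims by (simp add: mult_assoc_dim flip: st(5))
  also have "\<dots> = P ?j * ?E - P ?j * P ?j * ?E"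
    using dims by (simp add: mat_dim_simps)
  also have "P ?j * P ?j = P ?j"
    by (rule block_proj_mult_block_proj[OF V order_refl order_refl])
  also have "P ?j * ?E - P ?j * ?E = 0\<^sub>m n (2 * s)"
    using dims by (intro eq_matI) simp_all
  finally have "P ?j * V (Suc ?j) * H (Suc ?j) ?j = 0\<^sub>m n (2 * s)" .
  then have "P ?j * V (Suc ?j) = 0\<^sub>m n (2 * s)"
    by (rule right_cancel[OF mult_carrier_mat[OF carrier_matI[OF dims(1,2)] st(1)] st(3) S])
  then show ?case by (rule orthonormal_blocks_Suc[OF V st(1,2)])
qed

lemma orthonormal: "orthonormal_blocks n (2 * s) (Suc m) V"
  by (rule orthonormal_blocks_prefix) simp

lemmas block = orthonormal_blocksD(1-3)[OF orthonormal]
lemmas P_dim = block_proj_dim[OF orthonormal]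
lemmas P_block = block_proj_mult_block[OF orthonormal]
lemmas P_fixed_mono = block_proj_fixed_mono[OF orthonormal]

section \<open>How \<open>F\<close> acts on the nested spans\<close>

lemma block_recurrence:
  assumes "j \<in> {1..m}"
  shows "H (Suc j) j \<in> carrier_mat (2 * s) (2 * s)" "upper_triangular (H (Suc j) j)"
    "V (Suc j) * H (Suc j) j = eba_expand F s (V j) - P j * eba_expand F s (V j)"
  using gram_schmidt_step(3-5)[OF assms orthonormal_blocks_mono[OF orthonormal, of j]] assms by simp_all

text \<open>The expansion block is the sum of its projection \<open>P j * ?E\<close> and of
  \<open>V (Suc j) * H (Suc j) j\<close>; the larger projection fixes both.\<close>

lemma P_expand:
  assumes j: "j \<in> {1..m}"
  shows "P (Suc j) * eba_expand F s (V j) = eba_expand F s (V j)" (is "_ * ?E = _")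
proof -
  have j': "j \<in> {1..Suc m}" "j \<le> Suc m" "Suc j \<le> Suc m" "Suc j \<in> {1..Suc m}" using j by auto
  note dims = P_dim[OF j'(2)] P_dim[OF j'(3)] block(2,3)[OF j'(1)] block(2,3)[OF j'(4)]
  note st = block_recurrence[OF j]
  have 1: "P (Suc j) * (P j * ?E) = P j * ?E"
    using dims block_proj_mult_block_proj[OF orthonormal _ j'(3), of j]
    by (simp flip: mult_assoc_dim)
  have "P (Suc j) * (V (Suc j) * H (Suc j) j) = V (Suc j) * H (Suc j) j"
    using dims P_block[OF j'(3,4)] st(1) by (simp flip: mult_assoc_dim)
  then have "P (Suc j) * ?E - P j * ?E = ?E - P j * ?E"
    unfolding st(3) using dims 1 by (simp add: mult_diff_dim)
  then show ?thesis
    by (rule diff_right_cancel_mat) (use dims in simp_all)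
qed

text \<open>Only the first half of the expansion block contains \<open>F\<close> itself. The second
  half contains its inverse, so the last columns of \<open>V j\<close> need the separate argument of
  \<open>F_mult_block\<close>.\<close>

lemma P_first:
  assumes j: "j \<in> {1..m}"
  shows "P (Suc j) * (F * first_cols s (V j)) = F * first_cols s (V j)"
proof -
  have j': "j \<in> {1..Suc m}" "Suc j \<le> Suc m" using j by auto
  have "first_cols s (eba_expand F s (V j)) = F * first_cols s (V j)"
    using first_cols_append[of "F * first_cols s (V j)" "inv_mat F * last_cols s (V j)"]
    by (simp add: eba_expand_def)
  then show ?thesis
    using arg_cong[OF P_expand[OF j], of "first_cols s"] P_dim[OF j'(2)] block(2)[OF j'(1)]
    by (simp add: first_cols_mult)
qed

lemma last_cols_expand:
  "last_cols s (eba_expand F s U) = inv_mat F * last_cols s U"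
  using last_cols_append[of "F * first_cols s U" "inv_mat F * last_cols s U"]
  by (simp add: eba_expand_def)

lemma P_start: "P 1 * G = G"
proof -
  have "G = first_cols s (eba_start F G)"
    using first_cols_append[of G "inv_mat F * G"] by (simp add: eba_start_def)
  then have G_eq: "G = V 1 * first_cols s \<Lambda>"
    unfolding first_block(3) using first_block(1,4) by (simp add: first_cols_mult)
  have "P 1 * (V 1 * first_cols s \<Lambda>) = P 1 * V 1 * first_cols s \<Lambda>"
    using first_block(1,4) P_dim[of 1] by (simp add: mult_assoc_dim)
  then show ?thesis using P_block[of 1 1] G_eq by simp
qed

text \<open>Passes from single blocks to their span. The statement for blocks is a premise since it
  comes from the induction hypothesis of \<open>F_mult_block\<close>.\<close>

lemma P_mult_F_mult_P:
  assumes fixed: "\<And>i. i \<in> {1..j} \<Longrightarrow> P (Suc i) * (F * V i) = F * V i"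
    and j: "j \<le> m" "j < p" "p \<le> Suc m"
  shows "P p * (F * P j) = F * P j"
  using assms(1,2,3)
proof (induction j)
  case 0
  then show ?case using P_dim[OF j(3)] by (simp add: mult_zero_dim)
next
  case (Suc j)
  have S: "Suc j \<in> {1..Suc m}" "j \<le> Suc m" using Suc.prems by auto
  note dims = P_dim[OF j(3)] P_dim[OF S(2)] block(2,3)[OF S(1)]
  have IH: "P p * (F * P j) = F * P j" using Suc by simp
  have FV: "P p * (F * V (Suc j)) = F * V (Suc j)"
    by (rule P_fixed_mono[of "Suc (Suc j)"]) (use Suc.prems j in simp_all)
  have "P p * (F * P (Suc j)) = P p * (F * P j) + P p * (F * V (Suc j)) * (V (Suc j))\<^sup>T"
    using dims by (simp add: block_proj.simps(2) mat_dim_simps)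
  also have "\<dots> = F * P (Suc j)"
    unfolding IH FV using dims by (simp add: block_proj.simps(2) mat_dim_simps)
  finally show ?case .
qed

text \<open>With \<open>D = (I - P (j + 1)) F (V j)\<close>, the first \<open>s\<close> columns of \<open>D\<close> vanish by construction of
  \<open>V (j + 1)\<close>. The last ones are recovered from the triangular factor \<open>R\<close> that produced \<open>V j\<close>:
  \<open>F\<close> cancels the inverse of \<open>F\<close> in \<open>F (V j) R\<close>.\<close>

lemma F_mult_block:
  assumes "j \<in> {1..m}"
  shows "P (Suc j) * (F * V j) = F * V j"
  using assms
proof (induction j rule: less_induct)
  case (less j)
  have j: "j \<in> {1..Suc m}" "Suc j \<le> Suc m" using less.prems by auto
  \<comment> \<open>\<open>?N * M\<close> is the part of \<open>F * M\<close> outside the span of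
    the first \<open>j + 1\<close> blocks, so the goal is that \<open>?N * V j\<close>
    vanishes.\<close>
  let ?N = "F - P (Suc j) * F"
  note dims = P_dim[OF j(2)] block(2,3)[OF j(1)]
  have N: "?N * M = F * M - P (Suc j) * (F * M)" if "dim_row M = n" for M
    using that dims by (simp add: mat_dim_simps)
  have N0: "?N * M = 0\<^sub>m n (dim_col M)" if "dim_row M = n" "P (Suc j) * (F * M) = F * M" for M
    unfolding N[OF that(1)] that(2) by (intro eq_matI) auto
  \<comment> \<open>The initial QR factorisation and the recurrence are brought to one form, with
    \<open>R\<close> the triangular factor belonging to \<open>V j\<close> and \<open>S\<close> its
    right inverse.\<close>
  have "\<exists>R S. R \<in> carrier_mat (2 * s) (2 * s) \<and> upper_triangular R \<and>
      S \<in> carrier_mat (2 * s) (2 * s) \<and> R * S = 1\<^sub>m (2 * s) \<and> ?N * last_cols s (V j * R) = 0\<^sub>m n s"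
  proof (cases "j = 1")
    case True
    have "mrank (V 1 * \<Lambda>) = 2 * s"
      using no_breakdown first_block(3) start_dim by (simp add: eba_no_breakdown_def)
    then obtain S where S: "S \<in> carrier_mat (2 * s) (2 * s)" "\<Lambda> * S = 1\<^sub>m (2 * s)"
      using right_inverse_of_full_rank_factor[OF first_block(1,4)] by blast
    have "last_cols s (V 1 * \<Lambda>) = inv_mat F * G"
      unfolding first_block(3)[symmetric] eba_start_def
      using last_cols_append[of G "inv_mat F * G"] by simp
    moreover have "P (Suc 1) * G = G"
      by (rule P_fixed_mono[OF _ _ _ P_start]) (use less.prems in auto)
    ultimately have "?N * last_cols s (V 1 * \<Lambda>) = 0\<^sub>m n s"
      using N0[of "inv_mat F * G"] True by (simp add: F_mult_inv)
    then show ?thesis using S first_block(4,5) True by blast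
  next
    case False
    then obtain i where i: "j = Suc i" "i \<in> {1..m}" "i \<in> {1..Suc m}" "i \<le> Suc m"
      using less.prems by (cases j) auto
    note st = block_recurrence[OF i(2)]
    obtain S where S: "S \<in> carrier_mat (2 * s) (2 * s)" "H (Suc i) i * S = 1\<^sub>m (2 * s)"
      using H_right_inverse[OF i(2) st(1)] .
    let ?L = "last_cols s (V i)"
    let ?U = "inv_mat F * ?L"
    note dims = dims block(2,3)[OF i(3)] P_dim[OF i(4)]
    \<comment> \<open>Under \<open>F\<close>, the term \<open>?U\<close> becomes the last columns of
      \<open>V i\<close>, which lie in the span; the projected term \<open>P i * ?U\<close> is
      covered by the induction hypothesis for the blocks up to \<open>i\<close>.\<close>
    have VR: "last_cols s (V j * H (Suc i) i) = ?U - P i * ?U"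
      unfolding i(1) st(3) using dims
      by (simp add: last_cols_diff last_cols_mult last_cols_expand)
    have "P (Suc j) * ?L = ?L"
      using arg_cong[OF P_block[OF j(2) i(3)], of "last_cols s"] i(1) dims
      by (simp add: last_cols_mult)
    then have 1: "P (Suc j) * (F * ?U) = F * ?U"
      using dims by (simp add: F_mult_inv)
    have "P (Suc j) * (F * P i) = F * P i"
      using less i by (intro P_mult_F_mult_P) (auto)
    then have "P (Suc j) * (F * P i) * ?U = F * P i * ?U" by simp
    then have 2: "P (Suc j) * (F * (P i * ?U)) = F * (P i * ?U)"
      using dims by (simp add: mult_assoc_dim)
    have "P (Suc j) * (F * (?U - P i * ?U)) = F * (?U - P i * ?U)"
      using dims 1 2 by (simp add: mult_diff_dim)
    then have "?N * last_cols s (V j * H (Suc i) i) = 0\<^sub>m n s"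
      unfolding VR using dims by (subst N0) simp_all
    then show ?thesis using S st(1,2) by blast
  qed
  then obtain R S where R: "R \<in> carrier_mat (2 * s) (2 * s)" "upper_triangular R"
    and S: "S \<in> carrier_mat (2 * s) (2 * s)" "R * S = 1\<^sub>m (2 * s)"
    and last: "?N * last_cols s (V j * R) = 0\<^sub>m n s" by blast
  have D: "?N * V j \<in> carrier_mat n (2 * s)"
    using dims by (intro carrier_matI) simp_all
  have "first_cols s (?N * V j) = ?N * first_cols s (V j)"
    using dims by (intro first_cols_mult) simp_all
  then have first: "first_cols s (?N * V j) = 0\<^sub>m n s"
    using N0[OF _ P_first[OF less.prems]] dims by simp
  have "?N * V j * R = ?N * (V j * R)"
    using dims R by (simp add: mult_assoc_dim)
  then have "last_cols s (?N * V j * R) = ?N * last_cols s (V j * R)"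
    using dims R last_cols_mult[of ?N "V j * R" s] by simp
  \<comment> \<open>The first half of \<open>?N * V j\<close> and the last half of
    \<open>?N * V j * R\<close> vanish, so triangularity of \<open>R\<close> applies.\<close>
  then have "?N * V j * R = 0\<^sub>m n (2 * s)"
    using mult_upper_triangular_eq_0[of "?N * V j" n s R] D R first last by (simp only: mult_2)
  then have "F * V j - P (Suc j) * (F * V j) = 0\<^sub>m n (2 * s)"
    using right_cancel[OF D R(1) S] N dims by simp
  also have "\<dots> = P (Suc j) * (F * V j) - P (Suc j) * (F * V j)"
    using dims by (intro eq_matI) simp_all
  finally have "F * V j - P (Suc j) * (F * V j) = P (Suc j) * (F * V j) - P (Suc j) * (F * V j)" .
  from diff_right_cancel_mat[OF this] have "F * V j = P (Suc j) * (F * V j)"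
    using dims by simp
  then show ?case by simp
qed

section \<open>The concatenated basis and the Arnoldi relation\<close>

definition basis :: "real mat" where
  "basis = concat_blocks n (2 * s) m V"

lemma basis_dim [simp]: "dim_row basis = n" "dim_col basis = m * (2 * s)"
  by (simp_all add: basis_def)

lemma mult_basis:
  "dim_col M = n \<Longrightarrow> M * basis = concat_blocks (dim_row M) (2 * s) m (\<lambda>i. M * V i)"
  unfolding basis_def by (rule mult_concat_blocks[OF block(1)]) simp_all

lemma basis_orthonormal: "basis\<^sup>T * basis = 1\<^sub>m (m * (2 * s))"
  unfolding basis_def
  by (rule transpose_concat_blocks_mult[OF orthonormal_blocks_mono[OF orthonormal]]) simp

lemma P_basis: "basis * basis\<^sup>T = P m"
  unfolding basis_def by (rule concat_blocks_mult_transpose[OF orthonormal]) simp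

lemma next_block_orthogonal: "(V (Suc m))\<^sup>T * basis = 0\<^sub>m (2 * s) (m * (2 * s))"
proof -
  have "(V (Suc m))\<^sup>T * basis
      = concat_blocks (2 * s) (2 * s) m (\<lambda>i. (V (Suc m))\<^sup>T * V i)"
    using block(2,3)[of "Suc m"] by (simp add: mult_basis)
  also have "\<dots> = 0\<^sub>m (2 * s) (m * (2 * s))"
    using orthonormal_blocksD(4)[OF orthonormal, of "Suc m"] by (intro concat_blocks_0) auto
  finally show ?thesis .
qed

text \<open>The columns of \<open>G\<close> lie in the span of \<open>V 1\<close>, which
  \<open>1 \<le> m\<close> places inside the range of \<open>basis\<close>.\<close>

lemma basis_start: "basis * (basis\<^sup>T * G) = G" if "1 \<le> m"
proof -
  have "P m * G = G" by (rule P_fixed_mono[OF _ _ _ P_start]) (use that in auto)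
  then show ?thesis by (simp add: mult_assoc_dim flip: P_basis)
qed

text \<open>Every \<open>F * V i\<close> with \<open>i \<le> m\<close> is fixed by
  \<open>P (Suc m)\<close>, which is the sum of \<open>basis * basis\<^sup>T\<close> and the
  projection onto the next block.\<close>

lemma arnoldi_relation:
  "F * basis = basis * (basis\<^sup>T * F * basis) + V (Suc m) * ((V (Suc m))\<^sup>T * F * basis)"
proof -
  note dims = P_dim[OF order_refl] block(2,3)[of "Suc m"]
  have "P (Suc m) * F * basis = concat_blocks n (2 * s) m (\<lambda>i. P (Suc m) * F * V i)"
    using dims by (simp add: mult_basis)
  also have "\<dots> = concat_blocks n (2 * s) m (\<lambda>i. F * V i)"
  proof (rule concat_blocks_cong)
    fix i assume i: "i \<in> {1..m}"
    have "P (Suc m) * (F * V i) = F * V i"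
      by (rule P_fixed_mono[OF _ _ _ F_mult_block[OF i]]) (use i in simp_all)
    then show "P (Suc m) * F * V i = F * V i"
      using dims block(2,3)[of i] i by (simp add: mult_assoc_dim)
  qed
  also have "\<dots> = F * basis"
    by (simp add: mult_basis)
  finally have "F * basis = P (Suc m) * F * basis" by simp
  also have "\<dots> = basis * (basis\<^sup>T * F * basis) + V (Suc m) * ((V (Suc m))\<^sup>T * F * basis)"
    using dims by (simp add: block_proj.simps(2) mat_dim_simps flip: P_basis)
  finally show ?thesis .
qed

text \<open>For \<open>i < m\<close> the product \<open>F * V i\<close> stays in the span of the
  first \<open>m\<close> blocks, orthogonal to \<open>V (m + 1)\<close>. Only the last block of the
  coefficient survives; multiplied by \<open>Y\<close> it meets only the last rows, which replaces
  the factor \<open>E_m\<close>.\<close>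

lemma next_block_F_basis:
  assumes m: "1 \<le> m" and Y: "dim_row Y = m * (2 * s)"
  shows "(V (Suc m))\<^sup>T * F * basis * Y = (V (Suc m))\<^sup>T * F * V m * last_rows (2 * s) Y"
proof -
  obtain m' where m': "m = Suc m'" using m by (cases m) auto
  note dims = block(2,3)[of "Suc m"]
  let ?K = "\<lambda>i. (V (Suc m))\<^sup>T * F * V i"
  have "(V (Suc m))\<^sup>T * F * basis = concat_blocks (2 * s) (2 * s) m ?K"
    using dims by (simp add: mult_basis)
  also have "\<dots> = append_cols (concat_blocks (2 * s) (2 * s) m' ?K) (?K m)"
    unfolding m' using dims block(2,3)[of m] m'
    by (intro concat_blocks_Suc carrier_matI) simp_all
  also have "concat_blocks (2 * s) (2 * s) m' ?K = 0\<^sub>m (2 * s) (m' * (2 * s))"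
  proof (rule concat_blocks_0)
    fix i assume i: "i \<in> {1..m'}"
    then have i': "i \<in> {1..m}" "i \<in> {1..Suc m}" "Suc i \<le> Suc m" "\<not> Suc m \<le> Suc i" using m' by auto
    have "?K i = (V (Suc m))\<^sup>T * (P (Suc i) * (F * V i))"
      unfolding F_mult_block[OF i'(1)] using dims block(2,3)[OF i'(2)] by (simp add: mult_assoc_dim)
    also have "\<dots> = (V (Suc m))\<^sup>T * P (Suc i) * (F * V i)"
      using dims block(2,3)[OF i'(2)] P_dim[OF i'(3)] by (simp add: mult_assoc_dim)
    also have "(V (Suc m))\<^sup>T * P (Suc i) = 0\<^sub>m (2 * s) n"
      using transpose_block_mult_proj[OF orthonormal i'(3), of "Suc m"] i'(4) by simp
    finally show "?K i = 0\<^sub>m (2 * s) (2 * s)"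
      using block(2,3)[OF i'(2)] by (simp add: mult_zero_dim)
  qed
  finally show ?thesis
    using dims block(2,3)[of m] m' Y by (simp add: append_cols_mult mult_zero_dim) (rule eq_matI, auto)
qed

end

section \<open>The residual of the Riccati equation and its norm\<close>

theorem theorem3:
  fixes A B C :: "real mat" and n l s m :: nat and Tf :: real
    and V :: "nat \<Rightarrow> real mat" and \<Lambda> :: "real mat" and H :: "nat \<Rightarrow> nat \<Rightarrow> real mat"
    and Vm Tm Tsub Bm Cm :: "real mat" and Y X R :: "real \<Rightarrow> real mat"
  assumes A: "A \<in> carrier_mat n n" "invertible_mat A"
    and B: "B \<in> carrier_mat n l" "full_rank B"
    and C: "C \<in> carrier_mat s n" "full_rank C"
    and dims: "0 < l" "l < n" "0 < s" "s < n"
    and Tf: "0 < Tf"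
    and m: "1 \<le> m"
    and eba: "eba_process (A\<^sup>T) (C\<^sup>T) s m V \<Lambda> H"
    and no_breakdown: "eba_no_breakdown (A\<^sup>T) (C\<^sup>T) m H"
    and Vm: "Vm = concat_blocks n (2 * s) m V"
    and Tm: "Tm = Vm\<^sup>T * A\<^sup>T * Vm"
    and Tsub: "Tsub = (V (m + 1))\<^sup>T * A\<^sup>T * V m"
    and Bm: "Bm = Vm\<^sup>T * B"
    and Cm: "Cm = C * Vm"
    and Y_diff: "mat_differentiable_on Y (2 * m * s) (2 * m * s) {0..Tf}"
    and Y_sym: "\<forall>t\<in>{0..Tf}. (Y t)\<^sup>T = Y t"
    and Y_ode: "\<forall>t\<in>{0..Tf}.
      mat_deriv {0..Tf} Y t - Tm * Y t - Y t * Tm\<^sup>T + Y t * Bm * Bm\<^sup>T * Y t - Cm\<^sup>T * Cm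
        = 0\<^sub>m (2 * m * s) (2 * m * s)"
    and X: "\<forall>t\<in>{0..Tf}. X t = Vm * Y t * Vm\<^sup>T"
    and R: "\<forall>t\<in>{0..Tf}.
      R t = mat_deriv {0..Tf} X t - A\<^sup>T * X t - X t * A + X t * B * B\<^sup>T * X t - C\<^sup>T * C"
  shows "\<forall>t\<in>{0..Tf}. mnorm2 (R t) = mnorm2 (Tsub * last_rows (2 * s) (Y t))"
proof
  fix t assume t: "t \<in> {0..Tf}"
  interpret E: extended_block_arnoldi "A\<^sup>T" "C\<^sup>T" n s m V \<Lambda> H
    using A B C eba no_breakdown by unfold_locales (auto simp: invertible_mat_transpose)
  let ?p = "m * (2 * s)"
  have Vm_basis: "Vm = E.basis" by (simp add: Vm E.basis_def)
  \<comment> \<open>Reconciles the size written in the statement with the one coming from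
    \<open>m\<close> blocks of \<open>2 * s\<close> columns.\<close>
  have pm: "2 * m * s = ?p" by simp
  define D where "D = mat_deriv {0..Tf} Y t"
  define W where "W = V (Suc m)"
  define M where "M = Tsub * last_rows (2 * s) (Y t)"
  have Yt: "Y t \<in> carrier_mat ?p ?p"
    using Y_diff t by (simp add: mat_differentiable_on_def pm)
  have D: "D \<in> carrier_mat ?p ?p" using Yt by (auto simp: D_def mat_deriv_def)
  have ABC: "dim_row A = n" "dim_col A = n" "dim_row B = n" "dim_col B = l" "dim_row C = s" "dim_col C = n"
    using A B C by auto
  have Wc: "W \<in> carrier_mat n (2 * s)" unfolding W_def using E.block(1)[of "Suc m"] by simp
  have Vmc: "Vm \<in> carrier_mat n ?p" unfolding Vm_basis by (intro carrier_matI) simp_all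
  have last: "V m \<in> carrier_mat n (2 * s)" using E.block(1)[of m] m by simp
  have Mc: "M \<in> carrier_mat (2 * s) ?p"
    using carrier_matD[OF Yt] carrier_matD[OF Wc] carrier_matD[OF last] ABC
    by (intro carrier_matI) (simp_all add: M_def Tsub W_def)
  note dims = ABC carrier_matD[OF Yt] carrier_matD[OF D] carrier_matD[OF Wc] carrier_matD[OF Vmc]
    carrier_matD[OF Mc]
  have Ysym: "(Y t)\<^sup>T = Y t" using Y_sym t by blast
  have Xt: "X t = Vm * Y t * Vm\<^sup>T" using X t by blast
  have dX: "mat_deriv {0..Tf} X t = Vm * D * Vm\<^sup>T"
    unfolding D_def using Y_diff X Vmc
    by (intro mat_deriv_mult[OF Tf t, of Y ?p ?p]) (auto simp: pm)

  \<comment> \<open>The Arnoldi relation times \<open>Y t * Vm\<^sup>T\<close>: the term with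
    \<open>W\<close> is what leaves the range of \<open>Vm\<close>.\<close>
  have AX: "A\<^sup>T * X t = Vm * (Tm * Y t) * Vm\<^sup>T + W * M * Vm\<^sup>T"
  proof -
    have "A\<^sup>T * X t = A\<^sup>T * Vm * (Y t * Vm\<^sup>T)"
      unfolding Xt using dims by (simp add: mult_assoc_dim)
    also have "A\<^sup>T * Vm = Vm * Tm + W * (W\<^sup>T * A\<^sup>T * Vm)"
      unfolding Tm Vm_basis W_def by (rule E.arnoldi_relation)
    also have "(Vm * Tm + W * (W\<^sup>T * A\<^sup>T * Vm)) * (Y t * Vm\<^sup>T)
        = Vm * (Tm * Y t) * Vm\<^sup>T + W * (W\<^sup>T * A\<^sup>T * Vm * Y t) * Vm\<^sup>T"
      using dims by (simp add: mat_dim_simps Tm)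
    also have "W\<^sup>T * A\<^sup>T * Vm * Y t = M"
      unfolding M_def Tsub Vm_basis W_def using E.next_block_F_basis[OF m, of "Y t"] dims by simp
    finally show ?thesis .
  qed
  \<comment> \<open>Symmetry of \<open>Y t\<close> makes \<open>X t\<close> symmetric, so this is
    the transpose of \<open>AX\<close>.\<close>
  have XA: "X t * A = Vm * (Y t * Tm\<^sup>T) * Vm\<^sup>T + Vm * M\<^sup>T * W\<^sup>T"
  proof -
    have "X t * A = (A\<^sup>T * X t)\<^sup>T"
      unfolding Xt using dims Ysym by (simp add: mat_dim_simps)
    also have "\<dots> = Vm * (Y t * Tm\<^sup>T) * Vm\<^sup>T + Vm * M\<^sup>T * W\<^sup>T"
      unfolding AX using dims Ysym by (simp add: transpose_add_dim mat_dim_simps Tm)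
    finally show ?thesis .
  qed
  have XBX: "X t * B * B\<^sup>T * X t = Vm * (Y t * Bm * Bm\<^sup>T * Y t) * Vm\<^sup>T"
    unfolding Xt Bm using dims by (simp add: mat_dim_simps)
  have C_eq: "C\<^sup>T = Vm * Cm\<^sup>T"
    unfolding Cm Vm_basis using E.basis_start[OF m] ABC by (simp add: transpose_mult_dim)
  have CC: "C\<^sup>T * C = Vm * (Cm\<^sup>T * Cm) * Vm\<^sup>T"
  proof -
    have "C = Cm * Vm\<^sup>T"
      using arg_cong[OF C_eq, of transpose_mat] dims by (simp add: transpose_mult_dim Cm)
    then have "C\<^sup>T * C = Vm * Cm\<^sup>T * (Cm * Vm\<^sup>T)" using C_eq by simp
    then show ?thesis using dims by (simp add: mult_assoc_dim Cm)
  qed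

  \<comment> \<open>The reduced equation is placed between \<open>Vm\<close> and
    \<open>Vm\<^sup>T\<close>; it then accounts for all terms of the residual except the two
    containing \<open>W\<close>.\<close>
  have "Vm * (D - Tm * Y t - Y t * Tm\<^sup>T + Y t * Bm * Bm\<^sup>T * Y t - Cm\<^sup>T * Cm) * Vm\<^sup>T = 0\<^sub>m n n"
    using Y_ode t dims unfolding D_def pm by (simp add: mult_zero_dim)
  then have ode: "Vm * D * Vm\<^sup>T - Vm * (Tm * Y t) * Vm\<^sup>T - Vm * (Y t * Tm\<^sup>T) * Vm\<^sup>T
      + Vm * (Y t * Bm * Bm\<^sup>T * Y t) * Vm\<^sup>T - Vm * (Cm\<^sup>T * Cm) * Vm\<^sup>T = 0\<^sub>m n n"
    using dims by (simp add: mat_dim_simps Tm Bm Cm)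
  have "R t = Vm * D * Vm\<^sup>T - (Vm * (Tm * Y t) * Vm\<^sup>T + W * M * Vm\<^sup>T)
      - (Vm * (Y t * Tm\<^sup>T) * Vm\<^sup>T + Vm * M\<^sup>T * W\<^sup>T)
      + Vm * (Y t * Bm * Bm\<^sup>T * Y t) * Vm\<^sup>T - Vm * (Cm\<^sup>T * Cm) * Vm\<^sup>T"
    using R t by (simp only: dX AX XA XBX CC)
  also have "\<dots> = - (W * M * Vm\<^sup>T + Vm * M\<^sup>T * W\<^sup>T)"
  proof (rule eq_matI)
    fix i j assume "i < dim_row (- (W * M * Vm\<^sup>T + Vm * M\<^sup>T * W\<^sup>T))"
      "j < dim_col (- (W * M * Vm\<^sup>T + Vm * M\<^sup>T * W\<^sup>T))"
    then have ij: "i < n" "j < n" using dims by auto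
    show "(Vm * D * Vm\<^sup>T - (Vm * (Tm * Y t) * Vm\<^sup>T + W * M * Vm\<^sup>T)
      - (Vm * (Y t * Tm\<^sup>T) * Vm\<^sup>T + Vm * M\<^sup>T * W\<^sup>T)
      + Vm * (Y t * Bm * Bm\<^sup>T * Y t) * Vm\<^sup>T - Vm * (Cm\<^sup>T * Cm) * Vm\<^sup>T) $$ (i, j)
      = (- (W * M * Vm\<^sup>T + Vm * M\<^sup>T * W\<^sup>T)) $$ (i, j)"
      using arg_cong[OF ode, of "\<lambda>Z. Z $$ (i, j)"] ij dims
      \<comment> \<open>With these rules deleted, entries of products stay atomic, and linear
        arithmetic in them suffices.\<close>
      by (simp del: index_mult_mat(1) assoc_mult_mat)
  qed (use dims in simp_all)
  finally have R_eq: "R t = - (W * M * Vm\<^sup>T + Vm * M\<^sup>T * W\<^sup>T)" .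
  have "mnorm2 (W * M * Vm\<^sup>T + Vm * M\<^sup>T * W\<^sup>T) = mnorm2 M"
  proof (rule mnorm2_off_diagonal[OF Vmc _ Wc _ _ Mc])
    show "Vm\<^sup>T * Vm = 1\<^sub>m ?p" unfolding Vm_basis by (rule E.basis_orthonormal)
    show "W\<^sup>T * Vm = 0\<^sub>m (2 * s) ?p"
      unfolding Vm_basis W_def by (rule E.next_block_orthogonal)
    show "W\<^sup>T * W = 1\<^sub>m (2 * s)"
      unfolding W_def using orthonormal_blocksD(4)[OF E.orthonormal, of "Suc m" "Suc m"] by simp
  qed
  then show "mnorm2 (R t) = mnorm2 (Tsub * last_rows (2 * s) (Y t))"
    unfolding R_eq mnorm2_uminus M_def .
qed

end
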